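(* Consider first passage percolation on scale-free percolation (SFP) on $\mathbb{Z}^d$ with parameters $\alpha\in(1,2)$, $\tau>3$ and $\lambda>0$. Then, for every sufficiently small $\varepsilon>0$, $$\lim_{|x-y|\to\infty}\mathbb{P}\left(d_G^{\text{cost}}(x,y)\ge\bigl(\log|x-y|\bigr)^{\Delta\left(\min\{\alpha,\frac{\tau-1}{2}\}-\varepsilon\right)}\right)=1.$$
   Context: Scale-free percolation (SFP) with parameters $d\ge 1$, $\alpha>1$, $\tau>1$, $\lambda>0$: the vertex set is $\mathbb{Z}^d$, and $|\cdot|$ is the Euclidean norm. Each vertex $x$ independently draws a weight $w_x$ with $\mathbb{P}(w_x\ge z)=z^{1-\tau}$ for $z\ge1$. All nearest-neighbour grid edges of $\mathbb{Z}^d$ are present. In addition, conditionally on the weights, each pair $x\ne y$ is joined independently by a (long-range) edge with probability $\min\{1,\lambda(w_xw_y/|x-y|^d)^{\alpha}\}$. First passage percolation (FPP) on the resulting graph $G$: each edge $e$ of $G$ receives an independent cost $c_e$, exponentially distributed with rate $1$ (independent of $G$); the cost of a finite path is the sum of its edge costs, and $d_G^{\text{cost}}(x,y)$ is the infimum of the costs of all finite paths from $x$ to $y$. For $\beta\in(1,2)$, $\Delta(\beta)=1/\log_2(2/\beta)$. The limit is over pairs $x,y\in\mathbb{Z}^d$ whose Euclidean distance tends to infinity. *)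

theory Defs
  imports "HOL-Probability.Probability"
begin

text \<open>The vertex set \<open>\<int>\<^sup>d\<close> is the type \<open>int ^ 'd\<close> with \<open>d = CARD('d)\<close>.\<close>

definition eucl_dist :: "int ^ 'd \<Rightarrow> int ^ 'd \<Rightarrow> real"
  where "eucl_dist x y = norm (\<chi> i. real_of_int (x $ i - y $ i))"

definition vertex_pairs :: "(int ^ 'd) set set"
  where "vertex_pairs = {{x, y} | x y. x \<noteq> y}"

definition grid_edges :: "(int ^ 'd) set set"
  where "grid_edges = {{x, y} | x y. eucl_dist x y = 1}"

definition connection_prob ::
    "real \<Rightarrow> real \<Rightarrow> (int ^ 'd \<Rightarrow> real) \<Rightarrow> int ^ 'd \<Rightarrow> int ^ 'd \<Rightarrow> real"
  where "connection_prob \<alpha> lam w x y =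
    min 1 (lam * (w x * w y / eucl_dist x y ^ CARD('d)) powr \<alpha>)"

text \<open>
  \<open>W x\<close> is the weight of the vertex \<open>x\<close> and \<open>L\<close> the random set of long-range edges.
  In \<open>long_range_edges\<close> the set \<open>F\<close> lists finitely many distinct unordered pairs, each in one
  (arbitrary) orientation. The equation says that, conditionally on the \<open>\<sigma>\<close>-algebra generated by
  all weights, the events that \<open>{x, y}\<close> belongs to \<open>L\<close> are independent and have the prescribed
  probabilities.
\<close>

locale scale_free_percolation = prob_space M
  for M :: "'a measure" +
  fixes W :: "int ^ 'd \<Rightarrow> 'a \<Rightarrow> real"
    and L :: "'a \<Rightarrow> (int ^ 'd) set set"
    and \<alpha> \<tau> lam :: real
  assumes weights_indep: "indep_vars (\<lambda>_. borel) W UNIV"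
    and weights_tail: "\<And>x z. 1 \<le> z \<Longrightarrow> prob {\<omega> \<in> space M. z \<le> W x \<omega>} = z powr (1 - \<tau>)"
    and long_range_pairs: "\<And>\<omega>. \<omega> \<in> space M \<Longrightarrow> L \<omega> \<subseteq> vertex_pairs"
    and long_range_measurable: "\<And>e. {\<omega> \<in> space M. e \<in> L \<omega>} \<in> events"
    and long_range_edges:
      "\<And>F. finite F \<Longrightarrow> (\<And>x y. (x, y) \<in> F \<Longrightarrow> x \<noteq> y) \<Longrightarrow> inj_on (\<lambda>(x, y). {x, y}) F \<Longrightarrow>
        AE \<omega> in M.
          real_cond_exp M (vimage_algebra (space M) (\<lambda>\<omega> x. W x \<omega>) (\<Pi>\<^sub>M x\<in>UNIV. borel))
            (indicator {\<omega> \<in> space M. \<forall>(x, y)\<in>F. {x, y} \<in> L \<omega>}) \<omega>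
          = (\<Prod>(x, y)\<in>F. connection_prob \<alpha> lam (\<lambda>v. W v \<omega>) x y)"
begin

text \<open>The graph is simple: a grid edge that is also drawn as a long-range edge is a single edge.\<close>

definition edges :: "'a \<Rightarrow> (int ^ 'd) set set"
  where "edges \<omega> = grid_edges \<union> L \<omega>"

end

text \<open>
  The costs \<open>C e\<close> are attached to all pairs of vertices; only those of the edges of the graph are
  ever used.
\<close>

locale fpp_on_sfp = scale_free_percolation M W L \<alpha> \<tau> lam
  for M :: "'a measure" and W :: "int ^ 'd \<Rightarrow> 'a \<Rightarrow> real" and L \<alpha> \<tau> lam +
  fixes C :: "(int ^ 'd) set \<Rightarrow> 'a \<Rightarrow> real"
  assumes costs_indep: "indep_vars (\<lambda>_. borel) C vertex_pairs"
    and costs_distr: "\<And>e. e \<in> vertex_pairs \<Longrightarrow> distributed M lborel (C e) (exponential_density 1)"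
    and costs_indep_graph:
      "indep_set
        (sets (vimage_algebra (space M) (\<lambda>\<omega>. \<lambda>e\<in>vertex_pairs. e \<in> edges \<omega>)
          (\<Pi>\<^sub>M e\<in>vertex_pairs. count_space UNIV)))
        (sets (vimage_algebra (space M) (\<lambda>\<omega>. \<lambda>e\<in>vertex_pairs. C e \<omega>)
          (\<Pi>\<^sub>M e\<in>vertex_pairs. borel)))"

definition is_path :: "'v set set \<Rightarrow> 'v \<Rightarrow> 'v \<Rightarrow> 'v list \<Rightarrow> bool"
  where "is_path E x y p \<longleftrightarrow> p \<noteq> [] \<and> hd p = x \<and> last p = y \<and> distinct p \<and>
    successively (\<lambda>u v. {u, v} \<in> E) p"

definition path_cost :: "('v set \<Rightarrow> real) \<Rightarrow> 'v list \<Rightarrow> real"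
  where "path_cost c p = (\<Sum>(u, v)\<leftarrow>zip p (tl p). c {u, v})"

definition cost_dist :: "'v set set \<Rightarrow> ('v set \<Rightarrow> real) \<Rightarrow> 'v \<Rightarrow> 'v \<Rightarrow> ereal"
  where "cost_dist E c x y = (INF p\<in>{p. is_path E x y p}. ereal (path_cost c p))"

definition Delta :: "real \<Rightarrow> real"
  where "Delta \<beta> = 1 / log 2 (2 / \<beta>)"

end

theory Submission
  imports Defs "HOL-Library.Sublist" "HOL-Real_Asymp.Real_Asymp"
begin

text \<open>
  Write \<open>\<gamma> = min \<alpha> ((\<tau> - 1) / 2)\<close>. The proof is a first moment argument that needs three
  observations about paths without repeated vertices.

  First, every such path pays a price for each of its edges separately. For \<open>\<beta> < \<gamma>\<close> the
  connection probability is at most a constant times \<open>(w\<^sub>u w\<^sub>v)\<^sup>\<beta> |u - v|\<^sup>-\<^sup>\<beta>\<^sup>d\<close>. A vertex of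
  the path belongs to at most two of its edges, so the weights enter a product over edges of the
  path at most with the power \<open>2 \<beta> < \<tau> - 1\<close>, which has finite mean. Hence any prescribed set
  of edges of the path is present with probability at most the product of
  \<open>q u v = A |u - v|\<^sup>-\<^sup>\<beta>\<^sup>d\<close> over these edges (\<open>emeasure_edges_le_edge_weight\<close>); with
  \<open>A \<ge> 1\<close> this includes the edges of the grid.

  Second, with high probability no path from \<open>x\<close> of cost less than \<open>t\<close> has more than a certain
  multiple of \<open>t\<close> edges. Since \<open>\<beta> > 1\<close>, the sum \<open>Q\<close> of \<open>q u v\<close> over \<open>v\<close> is finite, so the
  paths with \<open>j\<close> edges from a given vertex have total weight at most \<open>Q\<^sup>j\<close>, whereas a sum of
  \<open>j\<close> exponential variables is below \<open>t\<close> with probability at most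
  \<open>exp (\<mu> t) (1 + \<mu>)\<^sup>-\<^sup>j\<close>, which for \<open>\<mu> = 2 Q\<close> beats \<open>Q\<^sup>j\<close> by a factor \<open>2\<^sup>-\<^sup>j\<close>
  (\<open>emeasure_cheap_path_le\<close>). So it suffices to bound the number of edges of the paths from
  \<open>x\<close> to \<open>y\<close> from below.

  Third, counting whole paths is too wasteful for that, because their number grows exponentially
  with their length; only a few long edges of a path should be recorded. A path with \<open>k\<close> edges
  from \<open>x\<close> to \<open>y\<close> has an edge of length at least \<open>|x - y| / k\<close>. It splits the path in two, each
  part can be treated in the same way, and a part whose end points are so close to each other that
  its existence is no restriction is forgotten. The edges that remain form a \<^emph>\<open>skeleton\<close>. Let
  \<open>a\<^sub>k\<close> be the total weight of the skeletons of paths with \<open>k\<close> edges, summed over all end points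
  \<open>y\<close>. Then the skeletons from \<open>x\<close> to \<open>y\<close> have weight at most
  \<open>T = A (|x - y| / k)\<^sup>-\<^sup>\<beta>\<^sup>d \<Sum>\<^sub>i a\<^sub>i a\<^sub>k\<^sub>-\<^sub>1\<^sub>-\<^sub>i\<close>, and at most 1. In place of \<open>min 1 T\<close> one
  may take \<open>T\<^sup>\<theta>\<close> with \<open>1 / \<beta> < \<theta> < 1\<close>, which is still summable over \<open>y\<close>, and gets the
  recursion \<open>a\<^sub>k \<approx> (\<Sum>\<^sub>i a\<^sub>i a\<^sub>k\<^sub>-\<^sub>1\<^sub>-\<^sub>i)\<^sup>\<theta>\<close> up to powers of \<open>k\<close>. With the ansatz
  \<open>a\<^sub>k = exp (C k\<^sup>\<rho>)\<close> the main contribution comes from \<open>i = k / 2\<close> and is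
  \<open>exp (\<theta> 2\<^sup>1\<^sup>-\<^sup>\<rho> C k\<^sup>\<rho>)\<close>, so the recursion closes as soon as \<open>2\<^sup>1\<^sup>-\<^sup>\<rho> < 1 / \<theta> < \<beta>\<close>
  (\<open>stretched_exponential_recursion\<close>, \<open>skeletons_exist\<close>). This is where \<open>\<Delta>\<close> comes from:
  \<open>2\<^sup>1\<^sup>-\<^sup>\<rho> = b\<close> means \<open>\<rho> = 1 / \<Delta> b\<close>.

  For \<open>k\<close> of order \<open>(ln |x - y|)\<^sup>a\<close> with \<open>a \<rho> < 1\<close> the growth \<open>exp (C k\<^sup>\<rho>)\<close> is
  \<open>|x - y|\<close> to the power \<open>o(1)\<close>, and the decay of \<open>T\<^sup>\<theta>\<close> in the distance wins.
\<close>

section \<open>Sums over countable index sets\<close>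

text \<open>
  Overlaps only help: one preimage of each element of the image suffices to pay for it.
\<close>

lemma nn_integral_count_space_image_le:
  fixes w :: "'b \<Rightarrow> ennreal"
  shows "(\<integral>\<^sup>+s. w s \<partial>count_space (f ` X)) \<le> (\<integral>\<^sup>+t. w (f t) \<partial>count_space X)"
proof -
  \<comment> \<open>A set of representatives, one for each value of \<open>f\<close>.\<close>
  define Y where "Y = inv_into X f ` (f ` X)"
  have "Y \<subseteq> X" unfolding Y_def by (auto intro: inv_into_into)
  have bij: "bij_betw f Y (f ` X)"
    unfolding Y_def bij_betw_def by (auto simp: inj_on_def f_inv_into_f image_comp)
  have "(\<integral>\<^sup>+s. w s \<partial>count_space (f ` X)) = (\<integral>\<^sup>+t. w (f t) \<partial>count_space Y)"
    by (rule nn_integral_bij_count_space[OF bij, symmetric])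
  also have "\<dots> \<le> (\<integral>\<^sup>+t. w (f t) \<partial>count_space X)"
    using \<open>Y \<subseteq> X\<close>
    by (auto simp: nn_integral_count_space_indicator indicator_def intro!: nn_integral_mono)
  finally show ?thesis .
qed

lemma nn_integral_count_space_Sigma:
  fixes f :: "'j \<times> 'b \<Rightarrow> ennreal"
  shows "(\<integral>\<^sup>+z. f z \<partial>count_space (Sigma J S))
    = (\<integral>\<^sup>+j. (\<integral>\<^sup>+s. f (j, s) \<partial>count_space (S j)) \<partial>count_space J)"
proof -
  have "(\<integral>\<^sup>+z. f z \<partial>count_space (Sigma J S))
      = (\<integral>\<^sup>+z. f z * indicator (Sigma J S) z \<partial>count_space UNIV)"
    by (simp add: nn_integral_count_space_indicator)
  also have "\<dots> = (\<integral>\<^sup>+j. (\<integral>\<^sup>+s. f (j, s) * indicator (Sigma J S) (j, s) \<partial>count_space UNIV) \<partial>count_space UNIV)"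
    by (rule nn_integral_fst_count_space[symmetric])
  also have "\<dots> = (\<integral>\<^sup>+j. (\<integral>\<^sup>+s. f (j, s) \<partial>count_space (S j)) * indicator J j \<partial>count_space UNIV)"
    by (intro nn_integral_cong)
      (auto simp: nn_integral_count_space_indicator indicator_def split: if_splits
        intro!: nn_integral_cong)
  finally show ?thesis by (simp add: nn_integral_count_space_indicator)
qed

lemma nn_integral_count_space_le_finite_sums:
  fixes f :: "'b :: countable \<Rightarrow> ennreal"
  assumes "\<And>B. finite B \<Longrightarrow> sum f B \<le> c"
  shows "(\<integral>\<^sup>+x. f x \<partial>count_space UNIV) \<le> c"
proof -
  define A where "A n = {x :: 'b. to_nat x \<le> n}" for n
  have fin: "finite (A n)" for n
    unfolding A_def by (rule finite_imageD[of to_nat]) (auto intro: finite_subset[of _ "{..n}"])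
  have "(\<integral>\<^sup>+x. f x \<partial>count_space UNIV) = (\<integral>\<^sup>+x. (SUP n. f x * indicator (A n) x) \<partial>count_space UNIV)"
  proof (intro nn_integral_cong antisym)
    fix x
    have "f x = f x * indicator (A (to_nat x)) x" by (simp add: A_def)
    also have "\<dots> \<le> (SUP n. f x * indicator (A n) x)" by (rule SUP_upper) simp
    finally show "f x \<le> (SUP n. f x * indicator (A n) x)" .
    show "(SUP n. f x * indicator (A n) x) \<le> f x"
      by (rule SUP_least) (auto simp: indicator_def)
  qed
  also have "\<dots> = (SUP n. \<integral>\<^sup>+x. f x * indicator (A n) x \<partial>count_space UNIV)"
    by (rule nn_integral_monotone_convergence_SUP)
      (auto simp: incseq_def le_fun_def A_def indicator_def)
  also have "\<dots> \<le> c"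
  proof (rule SUP_least)
    fix n
    have "(\<integral>\<^sup>+x. f x * indicator (A n) x \<partial>count_space UNIV) = (\<integral>\<^sup>+x. f x \<partial>count_space (A n))"
      by (simp add: nn_integral_count_space_indicator)
    also have "\<dots> = sum f (A n)" by (rule nn_integral_count_space_finite[OF fin])
    also have "\<dots> \<le> c" by (rule assms[OF fin])
    finally show "(\<integral>\<^sup>+x. f x * indicator (A n) x \<partial>count_space UNIV) \<le> c" .
  qed
  finally show ?thesis .
qed

text \<open>
  The union bound with the sum over the index set written as an integral, so that it combines with
  sums over families of skeletons and paths.
\<close>

lemma emeasure_UN_le_nn_integral:
  assumes "countable I" and [measurable]: "\<And>i. i \<in> I \<Longrightarrow> E i \<in> sets M"
  shows "emeasure M (\<Union>i\<in>I. E i) \<le> (\<integral>\<^sup>+i. emeasure M (E i) \<partial>count_space I)"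
proof -
  have "(\<Union>i\<in>I. E i) \<in> sets M" using assms by auto
  then have "emeasure M (\<Union>i\<in>I. E i) = (\<integral>\<^sup>+x. indicator (\<Union>i\<in>I. E i) x \<partial>M)" by simp
  also have "\<dots> \<le> (\<integral>\<^sup>+x. (\<integral>\<^sup>+i. indicator (E i) x \<partial>count_space I) \<partial>M)"
  proof (rule nn_integral_mono)
    fix x
    show "indicator (\<Union>i\<in>I. E i) x \<le> (\<integral>\<^sup>+i. indicator (E i) x \<partial>count_space I :: ennreal)"
    proof (cases "x \<in> (\<Union>i\<in>I. E i)")
      case True
      then obtain i where i: "i \<in> I" "x \<in> E i" by auto
      have "(1 :: ennreal) = (\<integral>\<^sup>+j. indicator {i} j \<partial>count_space I)" using i by simp
      also have "\<dots> \<le> (\<integral>\<^sup>+j. indicator (E j) x \<partial>count_space I)"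
        using i by (intro nn_integral_mono) (auto simp: indicator_def)
      finally show ?thesis using True by simp
    qed simp
  qed
  also have "\<dots> = (\<integral>\<^sup>+i. (\<integral>\<^sup>+x. indicator (E i) x \<partial>M) \<partial>count_space I)"
    using assms by (intro nn_integral_count_space_nn_integral) auto
  also have "\<dots> = (\<integral>\<^sup>+i. emeasure M (E i) \<partial>count_space I)"
    by (intro nn_integral_cong) (auto intro!: nn_integral_indicator)
  finally show ?thesis .
qed

section \<open>Power sums over the lattice\<close>

lemma eucl_dist_self [simp]: "eucl_dist x x = 0"
proof -
  have "(\<chi> i. real_of_int (x $ i - x $ i)) = 0" by (simp add: vec_eq_iff)
  then show ?thesis by (simp add: eucl_dist_def)
qed

lemma eucl_dist_commute: "eucl_dist x y = eucl_dist y x"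
proof -
  have "(\<chi> i. real_of_int (x $ i - y $ i)) = - (\<chi> i. real_of_int (y $ i - x $ i))"
    by (simp add: vec_eq_iff)
  then show ?thesis unfolding eucl_dist_def by (metis norm_minus_cancel)
qed

lemma eucl_dist_triangle: "eucl_dist x z \<le> eucl_dist x y + eucl_dist y z"
proof -
  have "(\<chi> i. real_of_int (x $ i - z $ i))
      = (\<chi> i. real_of_int (x $ i - y $ i)) + (\<chi> i. real_of_int (y $ i - z $ i))"
    by (simp add: vec_eq_iff)
  then show ?thesis unfolding eucl_dist_def by (simp only: norm_triangle_ineq)
qed

lemma eucl_dist_component_le: "\<bar>real_of_int (x $ i - y $ i)\<bar> \<le> eucl_dist x y"
  unfolding eucl_dist_def
  using component_le_norm_cart[of "\<chi> i. real_of_int (x $ i - y $ i)" i] by simp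

lemma eucl_dist_ge_1:
  assumes "x \<noteq> y"
  shows "1 \<le> eucl_dist x y"
proof -
  obtain i where "x $ i \<noteq> y $ i" using assms by (auto simp: vec_eq_iff)
  then have "1 \<le> \<bar>real_of_int (x $ i - y $ i)\<bar>" by linarith
  also have "\<dots> \<le> eucl_dist x y" by (rule eucl_dist_component_le)
  finally show ?thesis .
qed

text \<open>
  Bounds for all finite partial sums are the form in which the one-dimensional series can be
  multiplied up to dimension \<open>d\<close> without discussing summability.
\<close>

lemma int_powr_sums_bounded:
  fixes s :: real
  assumes "1 < s"
  shows "\<exists>c>0. \<forall>B. finite B \<longrightarrow> (\<Sum>m\<in>B. max 1 \<bar>real_of_int m\<bar> powr - s) \<le> c"
proof -
  define b where "b n = max 1 (real n) powr - s" for n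
  have "summable (\<lambda>n. real n powr - s)" using assms by (simp add: summable_real_powr_iff)
  moreover have ev: "\<forall>\<^sub>F n in sequentially. b n = real n powr - s"
    unfolding b_def by (rule eventually_sequentiallyI[of 1]) (auto simp: max_def)
  ultimately have sb: "summable b" using summable_cong[OF ev] by simp
  have b0: "0 \<le> b n" for n by (simp add: b_def)
  have "(\<Sum>m\<in>B. max 1 \<bar>real_of_int m\<bar> powr - s) \<le> 2 * suminf b + 1" if "finite B" for B
  proof -
    have "(\<Sum>m\<in>B. max 1 \<bar>real_of_int m\<bar> powr - s) = (\<Sum>m\<in>B. b (nat \<bar>m\<bar>))"
      by (simp add: b_def)
    also have "\<dots> = (\<Sum>m\<in>B \<inter> {0..}. b (nat \<bar>m\<bar>)) + (\<Sum>m\<in>B \<inter> {..<0}. b (nat \<bar>m\<bar>))"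
      using that by (subst sum.union_disjoint[symmetric]) (auto intro!: sum.cong)
    also have "(\<Sum>m\<in>B \<inter> {0..}. b (nat \<bar>m\<bar>)) = sum b ((\<lambda>m. nat \<bar>m\<bar>) ` (B \<inter> {0..}))"
      by (subst sum.reindex) (auto simp: inj_on_def)
    also have "(\<Sum>m\<in>B \<inter> {..<0}. b (nat \<bar>m\<bar>)) = sum b ((\<lambda>m. nat \<bar>m\<bar>) ` (B \<inter> {..<0}))"
      by (subst sum.reindex) (auto simp: inj_on_def)
    also have "sum b ((\<lambda>m. nat \<bar>m\<bar>) ` (B \<inter> {0..})) \<le> suminf b"
      using that by (intro sum_le_suminf sb) (auto simp: b0)
    also have "sum b ((\<lambda>m. nat \<bar>m\<bar>) ` (B \<inter> {..<0})) \<le> suminf b"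
      using that by (intro sum_le_suminf sb) (auto simp: b0)
    finally show ?thesis by simp
  qed
  moreover have "0 < 2 * suminf b + 1" using suminf_nonneg[OF sb b0] by simp
  ultimately show ?thesis by blast
qed

text \<open>
  A nonzero vector of the lattice has norm at least \<open>max 1 |z\<^sub>i|\<close> for each of its
  coordinates. Writing the power \<open>-s\<close> as a product of \<open>d\<close> powers \<open>-s / d\<close> therefore bounds
  the sum by the \<open>d\<close>-th power of a one-dimensional sum, whose exponent exceeds 1. The diagonal
  term \<open>y = x\<close> is harmless, because \<open>0 powr - s = 0\<close>.
\<close>

lemma lattice_powr_sum_bounded:
  fixes s :: real
  assumes s: "real CARD('d) < s"
  shows "\<exists>\<sigma>>0. \<forall>x :: int ^ 'd.
    (\<integral>\<^sup>+y. ennreal (eucl_dist x y powr - s) \<partial>count_space UNIV) \<le> ennreal \<sigma>"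
proof -
  define d where "d = CARD('d)"
  have d: "0 < d" by (simp add: d_def)
  define s' where "s' = s / real d"
  have s': "1 < s'" using s d by (simp add: s'_def d_def)
  define h where "h m = max 1 \<bar>real_of_int m\<bar> powr - s'" for m
  obtain c where c: "0 < c" "\<And>B. finite B \<Longrightarrow> sum h B \<le> c"
    using int_powr_sums_bounded[OF s'] unfolding h_def by blast
  have h0: "0 \<le> h m" for m by (simp add: h_def)
  have pointwise: "eucl_dist x y powr - s \<le> (\<Prod>i\<in>UNIV. h (y $ i - x $ i))" for x y :: "int ^ 'd"
  proof (cases "x = y")
    case True
    then show ?thesis by (simp add: h_def)
  next
    case False
    have "max 1 \<bar>real_of_int (y $ i - x $ i)\<bar> \<le> eucl_dist x y" for i
      using eucl_dist_ge_1[OF False] eucl_dist_component_le[of y i x]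
      by (simp add: eucl_dist_commute)
    then have le: "eucl_dist x y powr - s' \<le> h (y $ i - x $ i)" for i
      unfolding h_def using s' by (intro powr_mono2') auto
    have "eucl_dist x y powr - s = (\<Prod>i\<in>(UNIV :: 'd set). eucl_dist x y powr - s')"
      using d eucl_dist_ge_1[OF False] by (simp add: powr_power s'_def d_def)
    also have "\<dots> \<le> (\<Prod>i\<in>UNIV. h (y $ i - x $ i))"
      by (intro prod_mono) (auto simp: le)
    finally show ?thesis .
  qed
  have fin: "(\<Sum>y\<in>B. eucl_dist x y powr - s) \<le> c ^ d" if B: "finite B" for B and x :: "int ^ 'd"
  proof -
    define K where "K i = (\<lambda>y. y $ i) ` B" for i
    have finK: "finite (K i)" for i using B by (simp add: K_def)
    have "(\<Sum>y\<in>B. eucl_dist x y powr - s) \<le> (\<Sum>y\<in>B. \<Prod>i\<in>UNIV. h (y $ i - x $ i))"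
      by (intro sum_mono pointwise)
    also have "\<dots> = (\<Sum>f\<in>vec_nth ` B. \<Prod>i\<in>UNIV. h (f i - x $ i))"
      by (subst sum.reindex) (auto simp: inj_on_def vec_eq_iff)
    also have "\<dots> \<le> (\<Sum>f\<in>PiE UNIV K. \<Prod>i\<in>UNIV. h (f i - x $ i))"
      using finK by (intro sum_mono2 finite_PiE) (auto simp: K_def PiE_def intro!: prod_nonneg h0)
    also have "\<dots> = (\<Prod>i\<in>UNIV. \<Sum>m\<in>K i. h (m - x $ i))"
      using finK by (subst prod_sum_PiE) auto
    also have "\<dots> \<le> (\<Prod>i\<in>(UNIV :: 'd set). c)"
    proof (intro prod_mono conjI sum_nonneg h0)
      fix i
      have "(\<Sum>m\<in>K i. h (m - x $ i)) = sum h ((\<lambda>m. m - x $ i) ` K i)"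
        by (subst sum.reindex) (auto simp: inj_on_def)
      also have "\<dots> \<le> c" using finK by (intro c) auto
      finally show "(\<Sum>m\<in>K i. h (m - x $ i)) \<le> c" .
    qed
    finally show ?thesis by (simp add: d_def)
  qed
  have "(\<integral>\<^sup>+y. ennreal (eucl_dist x y powr - s) \<partial>count_space UNIV) \<le> ennreal (c ^ d)"
    for x :: "int ^ 'd"
    by (rule nn_integral_count_space_le_finite_sums)
      (auto simp: sum_ennreal intro!: ennreal_leI fin)
  moreover have "0 < c ^ d" using c by simp
  ultimately show ?thesis by blast
qed

section \<open>Paths, skeletons and their weights\<close>

definition path_edges :: "'v list \<Rightarrow> ('v \<times> 'v) list"
  where "path_edges p = zip p (tl p)"

definition edge_weight :: "('v \<Rightarrow> 'v \<Rightarrow> ennreal) \<Rightarrow> ('v \<times> 'v) list \<Rightarrow> ennreal"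
  where "edge_weight q S = prod_list (map (\<lambda>(u, v). q u v) S)"

text \<open>
  Weights are extended nonnegative reals and sums are integrals over a counting measure, since the
  families of edge lists that occur below are infinite.
\<close>

definition total_weight :: "('v \<Rightarrow> 'v \<Rightarrow> ennreal) \<Rightarrow> ('v \<times> 'v) list set \<Rightarrow> ennreal"
  where "total_weight q SS = (\<integral>\<^sup>+S. edge_weight q S \<partial>count_space SS)"

text \<open>
  The notion refers to all paths in the complete graph, so that a random graph enters only
  through the probability that a given list of edges is present. The family
  consisting of the empty list always qualifies; it stands for forgetting the path.
\<close>

definition skeletons :: "nat \<Rightarrow> 'v \<Rightarrow> 'v \<Rightarrow> ('v \<times> 'v) list set \<Rightarrow> bool"
  where "skeletons k x y SS \<longleftrightarrow>
    (\<forall>p. distinct p \<longrightarrow> length p = Suc k \<longrightarrow> hd p = x \<longrightarrow> last p = y \<longrightarrow>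
      (\<exists>S\<in>SS. subseq S (path_edges p)))"

lemma edge_weight_Nil [simp]: "edge_weight q [] = 1"
  and edge_weight_Cons [simp]: "edge_weight q ((u, v) # S) = q u v * edge_weight q S"
  and edge_weight_append [simp]: "edge_weight q (S @ T) = edge_weight q S * edge_weight q T"
  by (auto simp: edge_weight_def)

lemma path_edges_Nil [simp]: "path_edges [] = []"
  and path_edges_single [simp]: "path_edges [x] = []"
  and path_edges_Cons: "p \<noteq> [] \<Longrightarrow> path_edges (x # p) = (x, hd p) # path_edges p"
  by (auto simp: path_edges_def neq_Nil_conv)

lemma path_edges_append:
  assumes "p \<noteq> []" and "r \<noteq> []"
  shows "path_edges (p @ r) = path_edges p @ (last p, hd r) # path_edges r"
  using assms(1)
proof (induction p)
  case (Cons x p)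
  show ?case
  proof (cases "p = []")
    case True
    then show ?thesis using assms(2) by (simp add: path_edges_Cons)
  next
    case False
    then show ?thesis using Cons by (simp add: path_edges_Cons)
  qed
qed simp

lemma length_path_edges [simp]: "length (path_edges p) = length p - 1"
  by (simp add: path_edges_def)

lemma set_path_edges: "set (path_edges p) = {(p ! i, p ! Suc i) | i. Suc i < length p}"
  unfolding path_edges_def set_zip by (auto simp: nth_tl)

lemma distinct_path_edges: "distinct p \<Longrightarrow> distinct (path_edges p)"
  by (simp add: path_edges_def distinct_zipI1)

lemma path_edges_simple:
  assumes "distinct p"
  shows path_edges_fst_inj: "inj_on fst (set (path_edges p))"
    and path_edges_snd_inj: "inj_on snd (set (path_edges p))"
    and path_edges_doubleton_inj: "inj_on (\<lambda>(u, v). {u, v}) (set (path_edges p))"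
    and path_edges_no_loop: "(u, v) \<in> set (path_edges p) \<Longrightarrow> u \<noteq> v"
  using assms
  by (auto simp: set_path_edges inj_on_def nth_eq_iff_index_eq doubleton_eq_iff)

lemma successively_iff_path_edges:
  "successively R p \<longleftrightarrow> (\<forall>(u, v)\<in>set (path_edges p). R u v)"
proof (induction p)
  case (Cons x p)
  then show ?case by (cases p) (auto simp: path_edges_Cons)
qed simp

lemma path_edges_vertex_pairs:
  assumes "distinct p"
  shows "(\<lambda>(u, v). {u, v}) ` set (path_edges p) \<subseteq> vertex_pairs"
proof (clarify)
  fix u v assume "(u, v) \<in> set (path_edges p)"
  then show "{u, v} \<in> vertex_pairs"
    using path_edges_no_loop[OF assms] unfolding vertex_pairs_def by blast
qed

text \<open>
  Otherwise the triangle inequality would make the end points closer than they are.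
\<close>

lemma exists_long_step:
  fixes p :: "(int ^ 'd) list"
  assumes "length p = Suc k" and "0 < k"
  shows "\<exists>i<k. eucl_dist (hd p) (last p) / real k \<le> eucl_dist (p ! i) (p ! Suc i)"
proof (rule ccontr)
  assume neg: "\<not> ?thesis"
  have tri: "eucl_dist (p ! 0) (p ! n) \<le> (\<Sum>i<n. eucl_dist (p ! i) (p ! Suc i))" for n
  proof (induction n)
    case (Suc n)
    then show ?case
      using eucl_dist_triangle[of "p ! 0" "p ! Suc n" "p ! n"] by simp
  qed simp
  have "(\<Sum>i<k. eucl_dist (p ! i) (p ! Suc i)) < (\<Sum>i<k. eucl_dist (hd p) (last p) / real k)"
    using neg assms(2) by (intro sum_strict_mono) auto
  also have "\<dots> = eucl_dist (p ! 0) (p ! k)"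
    using assms by (cases p) (auto simp: last_conv_nth hd_conv_nth)
  finally show False using tri[of k] by simp
qed

text \<open>
  A skeleton composed of a left part, a long edge and a right part is weighted by the product of the
  three weights. If the weight of the edge is bounded by a constant, then the sums over its two end
  points factorize.
\<close>

lemma total_weight_split_le:
  fixes SS :: "nat \<Rightarrow> 'v \<Rightarrow> 'v \<Rightarrow> ('v \<times> 'v) list set"
  assumes q: "\<And>u v. R u v \<Longrightarrow> q u v \<le> c"
    and left: "\<And>i. i < k \<Longrightarrow> (\<integral>\<^sup>+u. total_weight q (SS i x u) \<partial>count_space UNIV) \<le> a i"
    and right: "\<And>i. i < k \<Longrightarrow> (\<integral>\<^sup>+v. total_weight q (SS i v y) \<partial>count_space UNIV) \<le> a i"
  shows "total_weight q {S @ (u, v) # T | i u v S T.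
      i < k \<and> R u v \<and> S \<in> SS i x u \<and> T \<in> SS (k - 1 - i) v y}
    \<le> c * (\<Sum>i<k. a i * a (k - 1 - i))"
proof -
  define D where "D = (SIGMA i:{..<k}. SIGMA u:UNIV. SIGMA v:{v. R u v}.
    SIGMA S:SS i x u. SS (k - 1 - i) v y)"
  define f where "f = (\<lambda>(i::nat, u::'v, v::'v, S::('v \<times> 'v) list, T). S @ (u, v) # T)"
  have eq: "{S @ (u, v) # T | i u v S T.
      i < k \<and> R u v \<and> S \<in> SS i x u \<and> T \<in> SS (k - 1 - i) v y} = f ` D"
  proof (intro equalityI subsetI)
    fix Z assume "Z \<in> {S @ (u, v) # T | i u v S T.
      i < k \<and> R u v \<and> S \<in> SS i x u \<and> T \<in> SS (k - 1 - i) v y}"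
    then obtain i u v S T where *: "Z = S @ (u, v) # T" "i < k" "R u v" "S \<in> SS i x u"
      "T \<in> SS (k - 1 - i) v y" by blast
    then show "Z \<in> f ` D"
      by (intro image_eqI[of _ _ "(i, u, v, S, T)"]) (simp_all add: f_def D_def)
  next
    fix Z assume "Z \<in> f ` D"
    then show "Z \<in> {S @ (u, v) # T | i u v S T.
      i < k \<and> R u v \<and> S \<in> SS i x u \<and> T \<in> SS (k - 1 - i) v y}"
      unfolding f_def D_def by (elim imageE SigmaE) (simp, blast)
  qed
  have "total_weight q (f ` D) \<le> (\<integral>\<^sup>+z. edge_weight q (f z) \<partial>count_space D)"
    unfolding total_weight_def by (rule nn_integral_count_space_image_le)
  also have "\<dots> = (\<integral>\<^sup>+i. (\<integral>\<^sup>+u. (\<integral>\<^sup>+v. q u v * total_weight q (SS (k - 1 - i) v y) * total_weight q (SS i x u)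
      \<partial>count_space {v. R u v}) \<partial>count_space UNIV) \<partial>count_space {..<k})"
    unfolding D_def nn_integral_count_space_Sigma f_def total_weight_def
    by (simp add: nn_integral_cmult nn_integral_multc mult_ac)
  also have "\<dots> \<le> (\<integral>\<^sup>+i. (\<integral>\<^sup>+u. (\<integral>\<^sup>+v. c * total_weight q (SS (k - 1 - i) v y) * total_weight q (SS i x u)
      \<partial>count_space UNIV) \<partial>count_space UNIV) \<partial>count_space {..<k})"
    by (intro nn_integral_mono)
      (auto simp: nn_integral_count_space_indicator indicator_def
        intro!: nn_integral_mono mult_right_mono q)
  also have "\<dots> = (\<integral>\<^sup>+i. c * (\<integral>\<^sup>+v. total_weight q (SS (k - 1 - i) v y) \<partial>count_space UNIV)
      * (\<integral>\<^sup>+u. total_weight q (SS i x u) \<partial>count_space UNIV) \<partial>count_space {..<k})"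
    by (simp add: nn_integral_cmult nn_integral_multc)
  also have "\<dots> \<le> (\<integral>\<^sup>+i. c * a (k - 1 - i) * a i \<partial>count_space {..<k})"
    by (intro nn_integral_mono mult_mono left right) auto
  also have "\<dots> = c * (\<Sum>i<k. a i * a (k - 1 - i))"
    by (simp add: nn_integral_count_space_finite sum_distrib_left mult_ac)
  finally show ?thesis unfolding eq .
qed

text \<open>
  Cutting a path at an edge of length at least \<open>|x - y| / k\<close> leaves two shorter self-avoiding
  paths, whose skeletons can be joined with that edge.
\<close>

lemma skeletons_split:
  fixes x y :: "int ^ 'd"
  assumes k: "0 < k"
    and SS: "\<And>i u v. i < k \<Longrightarrow> skeletons i u v (SS i u v)"
  shows "skeletons k x y {S @ (u, v) # T | i u v S T. i < k
    \<and> eucl_dist x y / real k \<le> eucl_dist u v \<and> S \<in> SS i x u \<and> T \<in> SS (k - 1 - i) v y}"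
  unfolding skeletons_def
proof (intro allI impI)
  fix p :: "(int ^ 'd) list"
  assume p: "distinct p" "length p = Suc k" "hd p = x" "last p = y"
  obtain i where i: "i < k" "eucl_dist x y / real k \<le> eucl_dist (p ! i) (p ! Suc i)"
    using exists_long_step[OF p(2) k] p by auto
  define r where "r = take (Suc i) p"
  define t where "t = drop (Suc i) p"
  have pr: "p = r @ t" by (simp add: r_def t_def)
  have lens: "length r = Suc i" "length t = Suc (k - 1 - i)"
    using p(2) i(1) by (auto simp: r_def t_def)
  then have ne: "r \<noteq> []" "t \<noteq> []" by auto
  have ends: "last r = p ! i" "hd t = p ! Suc i"
    using ne lens p(2) i(1) by (auto simp: last_conv_nth hd_conv_nth r_def t_def)
  have "hd r = x" "last t = y" using p ne by (auto simp: pr)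
  moreover have "distinct r" "distinct t" using p(1) by (auto simp: pr)
  moreover have "skeletons i x (p ! i) (SS i x (p ! i))"
    "skeletons (k - 1 - i) (p ! Suc i) y (SS (k - 1 - i) (p ! Suc i) y)"
    using SS i(1) k by auto
  ultimately have "\<exists>S\<in>SS i x (p ! i). subseq S (path_edges r)"
    and "\<exists>T\<in>SS (k - 1 - i) (p ! Suc i) y. subseq T (path_edges t)"
    using lens ends unfolding skeletons_def by blast+
  then obtain S T where S: "S \<in> SS i x (p ! i)" "subseq S (path_edges r)"
    and T: "T \<in> SS (k - 1 - i) (p ! Suc i) y" "subseq T (path_edges t)"
    by blast
  have "subseq (S @ (p ! i, p ! Suc i) # T) (path_edges p)"
    unfolding pr path_edges_append[OF ne]
    using S(2) T(2) by (auto simp: ends simp flip: pr intro!: list_emb_append_mono)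
  then show "\<exists>S\<in>{S @ (u, v) # T | i u v S T. i < k
    \<and> eucl_dist x y / real k \<le> eucl_dist u v \<and> S \<in> SS i x u \<and> T \<in> SS (k - 1 - i) v y}.
      subseq S (path_edges p)"
    using i S(1) T(1) by blast
qed

text \<open>
  The weight of a path is a product along its edges, so its end points can be summed out one by one.
\<close>

lemma total_weight_paths_le:
  assumes Q: "\<And>x. (\<integral>\<^sup>+y. q x y \<partial>count_space UNIV) \<le> Q"
  shows "(\<integral>\<^sup>+p. edge_weight q (path_edges p) \<partial>count_space {p. length p = Suc n \<and> hd p = x}) \<le> Q ^ n"
proof (induction n arbitrary: x)
  case 0
  have "{p. length p = Suc 0 \<and> hd p = x} = {[x]}" by (auto simp: length_Suc_conv)
  then show ?case by (simp add: nn_integral_count_space_finite)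
next
  case (Suc n)
  define P where "P m u = {p. length p = Suc m \<and> hd p = u}" for m and u :: 'a
  have img: "P (Suc n) x = (\<lambda>z. x # snd z) ` (SIGMA u:UNIV. P n u)"
    unfolding P_def by (auto simp: image_iff length_Suc_conv)
  have "(\<integral>\<^sup>+p. edge_weight q (path_edges p) \<partial>count_space (P (Suc n) x))
      \<le> (\<integral>\<^sup>+z. edge_weight q (path_edges (x # snd z)) \<partial>count_space (SIGMA u:UNIV. P n u))"
    unfolding img by (rule nn_integral_count_space_image_le)
  also have "\<dots> = (\<integral>\<^sup>+u. (\<integral>\<^sup>+p. edge_weight q (path_edges (x # p)) \<partial>count_space (P n u)) \<partial>count_space UNIV)"
    by (simp add: nn_integral_count_space_Sigma)
  also have "\<dots> = (\<integral>\<^sup>+u. (\<integral>\<^sup>+p. q x u * edge_weight q (path_edges p) \<partial>count_space (P n u)) \<partial>count_space UNIV)"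
    by (intro nn_integral_cong) (auto simp: P_def path_edges_Cons simp flip: length_greater_0_conv)
  also have "\<dots> = (\<integral>\<^sup>+u. q x u * (\<integral>\<^sup>+p. edge_weight q (path_edges p) \<partial>count_space (P n u)) \<partial>count_space UNIV)"
    by (simp add: nn_integral_cmult)
  also have "\<dots> \<le> (\<integral>\<^sup>+u. q x u * Q ^ n \<partial>count_space UNIV)"
    using Suc unfolding P_def by (intro nn_integral_mono mult_left_mono) auto
  also have "\<dots> = (\<integral>\<^sup>+u. q x u \<partial>count_space UNIV) * Q ^ n"
    by (simp add: nn_integral_multc)
  also have "\<dots> \<le> Q ^ Suc n" using Q by (simp add: mult_right_mono)
  finally show ?case unfolding P_def .
qed

section \<open>The recursion for the weight of skeletons\<close>

text \<open>
  Convexity of the power \<open>1 / \<rho>\<close>. The constant is the value at \<open>x = y\<close>: an even split of the path is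
  the one with the heaviest skeletons.
\<close>

lemma powr_sum_le:
  fixes x y \<rho> :: real
  assumes \<rho>: "0 < \<rho>" "\<rho> < 1" and "0 \<le> x" "0 \<le> y"
  shows "x powr \<rho> + y powr \<rho> \<le> 2 powr (1 - \<rho>) * (x + y) powr \<rho>"
proof (cases "x = 0 \<or> y = 0")
  case True
  have "(1::real) \<le> 2 powr (1 - \<rho>)" using \<rho> by (intro ge_one_powr_ge_zero) auto
  then have "1 * (x + y) powr \<rho> \<le> 2 powr (1 - \<rho>) * (x + y) powr \<rho>"
    by (intro mult_right_mono) auto
  then show ?thesis using True by auto
next
  case False
  then have pos: "0 < x" "0 < y" using assms by auto
  define a b where "a = x powr \<rho>" and "b = y powr \<rho>"
  have ab: "0 < a" "0 < b" using pos by (auto simp: a_def b_def)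
  have ax: "a powr (1 / \<rho>) = x" "b powr (1 / \<rho>) = y"
    using \<rho> pos by (auto simp: a_def b_def powr_powr)
  have "((1 - 1 / 2) *\<^sub>R a + (1 / 2) *\<^sub>R b) powr (1 / \<rho>)
      \<le> (1 - 1 / 2) * a powr (1 / \<rho>) + 1 / 2 * b powr (1 / \<rho>)"
    using \<rho> ab by (intro convex_onD[OF powr_convex]) auto
  then have "((a + b) / 2) powr (1 / \<rho>) \<le> (x + y) / 2"
    unfolding ax by (simp add: field_simps)
  then have "(((a + b) / 2) powr (1 / \<rho>)) powr \<rho> \<le> ((x + y) / 2) powr \<rho>"
    using \<rho> by (intro powr_mono2) auto
  then have "(a + b) / 2 \<le> ((x + y) / 2) powr \<rho>"
    using \<rho> ab by (simp add: powr_powr)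
  also have "\<dots> = (x + y) powr \<rho> / 2 powr \<rho>" using pos by (simp add: powr_divide)
  finally have "a + b \<le> 2 * ((x + y) powr \<rho> / 2 powr \<rho>)" by (simp add: mult.commute)
  also have "\<dots> = 2 powr (1 - \<rho>) * (x + y) powr \<rho>" by (simp add: powr_diff)
  finally show ?thesis by (simp add: a_def b_def)
qed

text \<open>
  The product of two stretched exponentials for the two parts of a path of length \<open>k\<close> is at most
  \<open>exp (C 2\<^sup>1\<^sup>-\<^sup>\<rho> k\<^sup>\<rho>)\<close>, and the power \<open>\<theta>\<close> makes the exponent
  \<open>\<theta> 2\<^sup>1\<^sup>-\<^sup>\<rho> C k\<^sup>\<rho>\<close> strictly smaller than \<open>C k\<^sup>\<rho>\<close>. The gap is proportional to \<open>C\<close>, so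
  that a large \<open>C\<close> absorbs the polynomial factors for all \<open>k\<close> simultaneously.
\<close>

lemma stretched_exponential_recursion:
  fixes A \<sigma> \<kappa> \<theta> \<rho> :: real
  assumes A: "0 < A" and \<sigma>: "0 < \<sigma>" and \<kappa>: "0 < \<kappa>" and \<theta>: "0 < \<theta>"
    and \<rho>: "0 < \<rho>" "\<rho> < 1" and small: "\<theta> * 2 powr (1 - \<rho>) < 1"
  shows "\<exists>C>0. \<forall>k>0.
    (A * real k powr \<kappa> * (\<Sum>i<k. exp (C * real i powr \<rho>) * exp (C * real (k - 1 - i) powr \<rho>))) powr \<theta>
      \<le> (exp (C * real k powr \<rho>) - 1) / \<sigma>"
proof -
  define b where "b = 2 powr (1 - \<rho>)"
  \<comment> \<open>The gap in the exponent that absorbs the polynomial factors.\<close>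
  define c where "c = 1 - \<theta> * b"
  have c: "0 < c" using small by (simp add: c_def b_def)
  define B where "B = 2 * \<sigma> * A powr \<theta>"
  define m where "m = (\<kappa> + 1) * \<theta>"
  have B: "0 < B" and m: "0 < m" using A \<sigma> \<kappa> \<theta> by (auto simp: B_def m_def)
  \<comment> \<open>The lower bound 1 gives \<open>exp (C k\<^sup>\<rho>) \<ge> 2\<close>, so that subtracting 1 at most halves it;
    the other bound is what the estimate \<open>ln k \<le> k\<^sup>\<rho> / \<rho>\<close> of the polynomial factor requires.\<close>
  define C where "C = max 1 ((\<bar>ln B\<bar> + m / \<rho>) / c)"
  have C1: "1 \<le> C" by (simp add: C_def)
  have Cc: "\<bar>ln B\<bar> + m / \<rho> \<le> C * c"
  proof -
    have "(\<bar>ln B\<bar> + m / \<rho>) / c \<le> C" by (simp add: C_def)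
    then show ?thesis using c by (simp add: divide_le_eq)
  qed
  have "(A * real k powr \<kappa> * (\<Sum>i<k. exp (C * real i powr \<rho>) * exp (C * real (k - 1 - i) powr \<rho>))) powr \<theta>
      \<le> (exp (C * real k powr \<rho>) - 1) / \<sigma>" if k: "0 < k" for k
  proof -
    define z where "z = real k powr \<rho>"
    have z1: "1 \<le> z" using k \<rho> by (auto simp: z_def intro: ge_one_powr_ge_zero)
    have "(\<Sum>i<k. exp (C * real i powr \<rho>) * exp (C * real (k - 1 - i) powr \<rho>))
        \<le> (\<Sum>i<k. exp (C * b * z))"
    proof (rule sum_mono)
      fix i assume "i \<in> {..<k}"
      then have "real i + real (k - 1 - i) \<le> real k" by auto
      then have "(real i + real (k - 1 - i)) powr \<rho> \<le> z"
        unfolding z_def using \<rho> by (intro powr_mono2) auto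
      then have "real i powr \<rho> + real (k - 1 - i) powr \<rho> \<le> b * z"
        by (intro order_trans[OF powr_sum_le[OF \<rho>]]) (auto simp: b_def)
      then have "C * (real i powr \<rho> + real (k - 1 - i) powr \<rho>) \<le> C * (b * z)"
        using C1 by (intro mult_left_mono) auto
      then show "exp (C * real i powr \<rho>) * exp (C * real (k - 1 - i) powr \<rho>) \<le> exp (C * b * z)"
        by (simp add: exp_add[symmetric] algebra_simps)
    qed
    also have "\<dots> = real k * exp (C * b * z)" by simp
    finally have sum: "(\<Sum>i<k. exp (C * real i powr \<rho>) * exp (C * real (k - 1 - i) powr \<rho>))
      \<le> real k * exp (C * b * z)" .
    have "(A * real k powr \<kappa> * (\<Sum>i<k. exp (C * real i powr \<rho>) * exp (C * real (k - 1 - i) powr \<rho>))) powr \<theta>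
        \<le> (A * real k powr \<kappa> * (real k * exp (C * b * z))) powr \<theta>"
      using A \<theta> sum by (intro powr_mono2 mult_left_mono mult_nonneg_nonneg sum_nonneg) auto
    also have "\<dots> = (A * real k powr (\<kappa> + 1) * exp (C * b * z)) powr \<theta>"
      using k by (simp add: powr_add mult_ac)
    also have "\<dots> = A powr \<theta> * real k powr m * exp (\<theta> * C * b * z)"
      using A k by (simp add: powr_mult powr_powr m_def exp_powr_real mult_ac)
    also have "\<dots> = B * real k powr m * exp (\<theta> * C * b * z) / (2 * \<sigma>)"
      using \<sigma> by (simp add: B_def)
    also have "B * real k powr m \<le> exp (C * c * z)"
    proof -
      have "ln (real k) \<le> z / \<rho>"
        unfolding z_def using k \<rho> by (intro ln_powr_bound) auto
      then have "m * ln (real k) \<le> m * (z / \<rho>)" using m by (intro mult_left_mono) auto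
      moreover have "\<bar>ln B\<bar> * 1 \<le> \<bar>ln B\<bar> * z" using z1 by (intro mult_left_mono) auto
      ultimately have "ln B + m * ln (real k) \<le> (\<bar>ln B\<bar> + m / \<rho>) * z"
        using abs_ge_self[of "ln B"] by (simp add: algebra_simps)
      also have "\<dots> \<le> C * c * z" using Cc z1 by (intro mult_right_mono) auto
      finally have "exp (ln B + m * ln (real k)) \<le> exp (C * c * z)" by simp
      then show ?thesis using B k by (simp add: exp_add powr_def)
    qed
    also have "exp (C * c * z) * exp (\<theta> * C * b * z) = exp (C * z)"
      unfolding exp_add[symmetric] by (simp add: c_def algebra_simps)
    also have "exp (C * z) / (2 * \<sigma>) \<le> (exp (C * z) - 1) / \<sigma>"
    proof -
      have "1 * 1 \<le> C * z" using C1 z1 by (intro mult_mono) auto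
      then have "1 + 1 \<le> exp (C * z)" using exp_ge_add_one_self[of "C * z"] by linarith
      then show ?thesis using \<sigma> by (simp add: field_simps)
    qed
    finally show ?thesis using \<sigma> by (simp add: z_def divide_right_mono)
  qed
  then show ?thesis using C1 by (intro exI[of _ C]) auto
qed

text \<open>
  Induction on \<open>k\<close>. Let \<open>t\<close> be the weight obtained by splitting at a long edge. If \<open>t\<close> is
  below 1, splitting is worthwhile and \<open>t \<le> t\<^sup>\<theta>\<close>; otherwise the path is forgotten at the price
  \<open>1 \<le> t\<^sup>\<theta>\<close>. The bound \<open>t\<^sup>\<theta>\<close> decays in \<open>|x - y|\<close> with the exponent \<open>\<theta> \<kappa>\<close>, for which the
  lattice sum is at most \<open>\<sigma>\<close>; so \<open>a k\<close> bounds the sum over \<open>y\<close>, which keeps the induction going. The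
  diagonal \<open>x = y\<close>, where the power of the distance is 0, contributes the separate term 1.
\<close>

lemma skeletons_exist:
  fixes x y :: "int ^ 'd"
  assumes A: "0 < A" and \<theta>: "0 < \<theta>" "\<theta> \<le> 1" and \<sigma>: "0 < \<sigma>"
    and lattice: "\<And>x :: int ^ 'd.
      (\<integral>\<^sup>+y. ennreal (eucl_dist x y powr - (\<theta> * \<kappa>)) \<partial>count_space UNIV) \<le> ennreal \<sigma>"
    and a1: "\<And>k. 1 \<le> a k" and \<kappa>: "0 < \<kappa>"
    and rec: "\<And>k. 0 < k \<Longrightarrow>
      (A * real k powr \<kappa> * (\<Sum>i<k. a i * a (k - 1 - i))) powr \<theta> \<le> (a k - 1) / \<sigma>"
  shows "\<exists>SS. skeletons k x y SS \<and>
    total_weight (\<lambda>u v. ennreal (A * eucl_dist u v powr - \<kappa>)) SS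
      \<le> ennreal ((a k - 1) / \<sigma> * eucl_dist x y powr - (\<theta> * \<kappa>) + of_bool (x = y))"
proof (induction k arbitrary: x y rule: less_induct)
  case (less k)
  let ?q = "\<lambda>u v :: int ^ 'd. ennreal (A * eucl_dist u v powr - \<kappa>)"
  let ?g = "\<lambda>k x y :: int ^ 'd. (a k - 1) / \<sigma> * eucl_dist x y powr - (\<theta> * \<kappa>) + of_bool (x = y)"
  have trivial: "skeletons k x y {[]}" "total_weight ?q {[]} = 1"
    by (auto simp: skeletons_def total_weight_def nn_integral_count_space_finite)
  consider "x = y" | "x \<noteq> y" "k = 0" | "x \<noteq> y" "0 < k" by blast
  then show ?case
  proof cases
    case 1
    then show ?thesis using trivial by (intro exI[of _ "{[]}"]) simp
  next
    case 2
    then have "skeletons k x y {}" by (auto simp: skeletons_def length_Suc_conv)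
    then show ?thesis by (intro exI[of _ "{}"]) (simp add: total_weight_def nn_integral_count_space_finite)
  next
    case 3
    define D where "D = eucl_dist x y"
    have D: "1 \<le> D" using eucl_dist_ge_1[OF 3(1)] by (simp add: D_def)
    define G where "G = A * real k powr \<kappa> * (\<Sum>i<k. a i * a (k - 1 - i))"
    have a0: "0 \<le> a i" for i using a1[of i] by simp
    have G: "0 \<le> G" using A by (auto simp: G_def intro!: mult_nonneg_nonneg sum_nonneg a0)
    \<comment> \<open>The weight of all skeletons that arise by splitting at a long edge.\<close>
    define t where "t = G * D powr - \<kappa>"
    have t: "0 \<le> t" using G by (simp add: t_def)
    have "t powr \<theta> = G powr \<theta> * D powr - (\<theta> * \<kappa>)"
      using G by (simp add: t_def powr_mult powr_powr mult_ac)
    also have "\<dots> \<le> (a k - 1) / \<sigma> * D powr - (\<theta> * \<kappa>)"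
      unfolding G_def using rec[OF 3(2)] by (intro mult_right_mono) auto
    finally have final: "t powr \<theta> \<le> ?g k x y" using 3 by (simp add: D_def)
    show ?thesis
    proof (cases "1 \<le> t")
      case True
      then have "1 \<le> t powr \<theta>" using \<theta> by (intro ge_one_powr_ge_zero) auto
      then have "1 \<le> ?g k x y" using final by linarith
      then show ?thesis using trivial by (intro exI[of _ "{[]}"]) simp
    next
      case False
      define SS where "SS i u v = (SOME SS. skeletons i u v SS \<and>
        total_weight ?q SS \<le> ennreal (?g i u v))" for i u v
      have SS: "skeletons i u v (SS i u v)" "total_weight ?q (SS i u v) \<le> ennreal (?g i u v)"
        if "i < k" for i u v
        using someI_ex[OF less.IH[OF that, of u v]] unfolding SS_def by blast+
      have delta: "(\<integral>\<^sup>+v. ennreal (of_bool (u = v)) \<partial>count_space UNIV) = 1" for u :: "int ^ 'd"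
      proof -
        have "(\<integral>\<^sup>+v. ennreal (of_bool (u = v)) \<partial>count_space UNIV)
            = (\<integral>\<^sup>+v. indicator {u} v \<partial>count_space UNIV)"
          by (intro nn_integral_cong) (auto simp: indicator_def)
        then show ?thesis by simp
      qed
      have int_g: "(\<integral>\<^sup>+v. ennreal (?g i u v) \<partial>count_space UNIV) \<le> ennreal (a i)" for i u
      proof -
        have "(\<integral>\<^sup>+v. ennreal (?g i u v) \<partial>count_space UNIV)
            = (\<integral>\<^sup>+v. ennreal ((a i - 1) / \<sigma>) * ennreal (eucl_dist u v powr - (\<theta> * \<kappa>))
                + ennreal (of_bool (u = v)) \<partial>count_space UNIV)"
          using a1[of i] \<sigma> by (intro nn_integral_cong) (simp add: ennreal_plus flip: ennreal_mult)
        also have "\<dots> = ennreal ((a i - 1) / \<sigma>) *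
            (\<integral>\<^sup>+v. ennreal (eucl_dist u v powr - (\<theta> * \<kappa>)) \<partial>count_space UNIV) + 1"
          by (simp add: nn_integral_add nn_integral_cmult delta)
        also have "\<dots> \<le> ennreal ((a i - 1) / \<sigma>) * ennreal \<sigma> + ennreal 1"
          by (intro add_mono mult_left_mono lattice) auto
        also have "\<dots> = ennreal (a i)"
          using a1[of i] \<sigma> by (simp del: ennreal_1 flip: ennreal_mult ennreal_plus)
        finally show ?thesis .
      qed
      define R where "R u v \<longleftrightarrow> D / real k \<le> eucl_dist u v" for u v :: "int ^ 'd"
      define TT where "TT = {S @ (u, v) # T | i u v S T. i < k \<and> R u v
        \<and> S \<in> SS i x u \<and> T \<in> SS (k - 1 - i) v y}"
      have "skeletons k x y TT"
        unfolding TT_def R_def D_def by (intro skeletons_split 3 SS)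
      moreover have "total_weight ?q TT \<le> ennreal (A * (D / real k) powr - \<kappa>)
          * (\<Sum>i<k. ennreal (a i) * ennreal (a (k - 1 - i)))"
        unfolding TT_def
      proof (rule total_weight_split_le)
        fix u v assume "R u v"
        then show "?q u v \<le> ennreal (A * (D / real k) powr - \<kappa>)"
          unfolding R_def using A \<kappa> D 3 by (intro ennreal_leI mult_left_mono powr_mono2') auto
      next
        fix i assume i: "i < k"
        have "(\<integral>\<^sup>+u. total_weight ?q (SS i x u) \<partial>count_space UNIV)
            \<le> (\<integral>\<^sup>+u. ennreal (?g i x u) \<partial>count_space UNIV)"
          by (intro nn_integral_mono SS i)
        also note int_g
        finally show "(\<integral>\<^sup>+u. total_weight ?q (SS i x u) \<partial>count_space UNIV) \<le> ennreal (a i)" .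
        have "(\<integral>\<^sup>+v. total_weight ?q (SS i v y) \<partial>count_space UNIV)
            \<le> (\<integral>\<^sup>+v. ennreal (?g i v y) \<partial>count_space UNIV)"
          by (intro nn_integral_mono SS i)
        also have "\<dots> = (\<integral>\<^sup>+v. ennreal (?g i y v) \<partial>count_space UNIV)"
          by (simp add: eucl_dist_commute[of _ y] eq_commute[of _ y])
        also note int_g
        finally show "(\<integral>\<^sup>+v. total_weight ?q (SS i v y) \<partial>count_space UNIV) \<le> ennreal (a i)" .
      qed
      moreover have "ennreal (A * (D / real k) powr - \<kappa>)
          * (\<Sum>i<k. ennreal (a i) * ennreal (a (k - 1 - i))) = ennreal t"
      proof -
        have "ennreal (A * (D / real k) powr - \<kappa>)
          * (\<Sum>i<k. ennreal (a i) * ennreal (a (k - 1 - i)))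
          = ennreal (A * (D / real k) powr - \<kappa> * (\<Sum>i<k. a i * a (k - 1 - i)))"
          using A by (simp add: a0 sum_nonneg flip: ennreal_mult)
        also have "A * (D / real k) powr - \<kappa> * (\<Sum>i<k. a i * a (k - 1 - i)) = t"
          using D 3 by (simp add: t_def G_def powr_divide powr_minus field_simps)
        finally show ?thesis .
      qed
      moreover have "ennreal t \<le> ennreal (?g k x y)"
      proof -
        have "t powr 1 \<le> t powr \<theta>"
          using False t \<theta> powr_mono'[of \<theta> 1 t] by simp
        then show ?thesis using t final by (intro ennreal_leI) simp
      qed
      ultimately show ?thesis by (intro exI[of _ TT]) auto
    qed
  qed
qed

section \<open>Prescribed edges in scale-free percolation\<close>

text \<open>
  The minimum of 1 and \<open>lam z\<^sup>\<alpha>\<close> is at most \<open>max 1 lam z\<^sup>\<beta>\<close> for each exponent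
  \<open>\<beta> \<le> \<alpha>\<close>: for \<open>z \<le> 1\<close> the smaller exponent gives the larger power, and for \<open>z > 1\<close>
  the power is larger than 1.
\<close>

lemma connection_prob_le:
  fixes x y :: "int ^ 'd"
  assumes "0 < \<beta>" "\<beta> \<le> \<alpha>" "0 < lam" "x \<noteq> y" "1 \<le> w x" "1 \<le> w y"
  shows "connection_prob \<alpha> lam w x y
    \<le> max 1 lam * eucl_dist x y powr - (\<beta> * real CARD('d)) * (w x powr \<beta> * w y powr \<beta>)"
proof -
  define D where "D = eucl_dist x y"
  have D: "1 \<le> D" using eucl_dist_ge_1[OF assms(4)] by (simp add: D_def)
  define z where "z = w x * w y / D ^ CARD('d)"
  have z: "0 < z" using assms D by (simp add: z_def)
  have eq: "max 1 lam * D powr - (\<beta> * real CARD('d)) * (w x powr \<beta> * w y powr \<beta>) = max 1 lam * z powr \<beta>"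
  proof -
    have "z = w x * w y * D powr - real CARD('d)"
      using D by (simp add: z_def powr_minus divide_inverse powr_realpow)
    then show ?thesis using D assms by (simp add: powr_mult powr_powr mult_ac)
  qed
  have "min 1 (lam * z powr \<alpha>) \<le> max 1 lam * z powr \<beta>"
  proof (cases "z \<le> 1")
    case True
    then have "z powr \<alpha> \<le> z powr \<beta>" using z assms by (intro powr_mono') auto
    then have "lam * z powr \<alpha> \<le> max 1 lam * z powr \<beta>" using assms by (intro mult_mono) auto
    then show ?thesis by simp
  next
    case False
    then have "1 \<le> z powr \<beta>" using assms by (intro ge_one_powr_ge_zero) auto
    then have "1 * 1 \<le> max 1 lam * z powr \<beta>" by (intro mult_mono) auto
    then show ?thesis by simp
  qed
  then show ?thesis unfolding connection_prob_def eq[unfolded D_def] z_def D_def .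
qed

context scale_free_percolation
begin

lemma weights_measurable [measurable]: "W x \<in> borel_measurable M"
  using weights_indep by (simp add: indep_vars_def)

lemma weights_ge_1: "AE \<omega> in M. 1 \<le> W x \<omega>"
  using weights_tail[of 1 x] by (subst prob_Collect_eq_1[symmetric]) auto

text \<open>
  Dyadic decomposition: \<open>w\<^sup>s\<close> is at most \<open>2\<^sup>(\<^sup>j\<^sup>+\<^sup>1\<^sup>)\<^sup>s\<close> for the largest \<open>j\<close> with \<open>2\<^sup>j \<le> w\<close>,
  and the tail of the weights turns the expectation into a geometric series.
\<close>

lemma weight_moments_bounded:
  assumes s: "0 \<le> s" "s < \<tau> - 1"
  shows "\<exists>m\<ge>1. \<forall>x. (\<integral>\<^sup>+\<omega>. ennreal (W x \<omega> powr s) \<partial>M) \<le> ennreal m"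
proof -
  define r where "r = 2 powr (s + 1 - \<tau>)"
  have r: "0 < r" "r < 1" using s unfolding r_def by (auto simp: powr_less_one)
  define m where "m = max 1 (2 powr s * (1 / (1 - r)))"
  have "(\<integral>\<^sup>+\<omega>. ennreal (W x \<omega> powr s) \<partial>M) \<le> ennreal m" for x
  proof -
    define E where "E j = {\<omega> \<in> space M. 2 ^ j \<le> W x \<omega>}" for j :: nat
    have E [measurable]: "E j \<in> events" for j by (simp add: E_def)
    have "AE \<omega> in M. ennreal (W x \<omega> powr s)
        \<le> (\<Sum>j. ennreal (2 powr (real (Suc j) * s)) * indicator (E j) \<omega>)"
      using weights_ge_1[of x] AE_space
    proof eventually_elim
      fix \<omega> assume w: "1 \<le> W x \<omega>" "\<omega> \<in> space M"
      define j where "j = nat \<lfloor>log 2 (W x \<omega>)\<rfloor>"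
      have log0: "0 \<le> log 2 (W x \<omega>)" using w by simp
      have "real j \<le> log 2 (W x \<omega>)" "log 2 (W x \<omega>) \<le> real (Suc j)"
        unfolding j_def using log0 by linarith+
      then have "2 powr real j \<le> W x \<omega>" "W x \<omega> \<le> 2 powr real (Suc j)"
        using w by (auto simp: le_log_iff log_le_iff)
      then have j: "\<omega> \<in> E j" "W x \<omega> powr s \<le> (2 powr real (Suc j)) powr s"
        using w s by (auto simp: E_def powr_realpow simp del: of_nat_Suc intro!: powr_mono2)
      define f where "f j = ennreal (2 powr (real (Suc j) * s)) * indicator (E j) \<omega>" for j
      have "ennreal (W x \<omega> powr s) \<le> f j"
        using j by (simp add: f_def powr_powr)
      also have "f j \<le> suminf f"
        using sum_le_suminf[of f "{j}"] by simp
      finally show "ennreal (W x \<omega> powr s)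
        \<le> (\<Sum>j. ennreal (2 powr (real (Suc j) * s)) * indicator (E j) \<omega>)"
        unfolding f_def .
    qed
    then have "(\<integral>\<^sup>+\<omega>. ennreal (W x \<omega> powr s) \<partial>M)
        \<le> (\<integral>\<^sup>+\<omega>. (\<Sum>j. ennreal (2 powr (real (Suc j) * s)) * indicator (E j) \<omega>) \<partial>M)"
      by (rule nn_integral_mono_AE)
    also have "\<dots> = (\<Sum>j. ennreal (2 powr (real (Suc j) * s)) * emeasure M (E j))"
      by (subst nn_integral_suminf) (auto simp: nn_integral_cmult_indicator)
    also have "\<dots> = (\<Sum>j. ennreal (2 powr s * r ^ j))"
    proof (intro suminf_cong)
      fix j
      have "emeasure M (E j) = ennreal ((2 ^ j) powr (1 - \<tau>))"
        unfolding emeasure_eq_measure E_def by (subst weights_tail) auto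
      moreover have "2 powr (real (Suc j) * s) * (2 ^ j) powr (1 - \<tau>) = 2 powr s * r ^ j"
        by (simp add: r_def powr_powr flip: powr_realpow powr_add) (simp add: algebra_simps)
      ultimately show "ennreal (2 powr (real (Suc j) * s)) * emeasure M (E j) = ennreal (2 powr s * r ^ j)"
        by (simp flip: ennreal_mult)
    qed
    also have "\<dots> = ennreal (2 powr s * (1 / (1 - r)))"
      using r by (intro suminf_ennreal_eq sums_mult geometric_sums) auto
    also have "\<dots> \<le> ennreal m" unfolding m_def by (intro ennreal_leI) auto
    finally show ?thesis .
  qed
  moreover have "1 \<le> m" by (simp add: m_def)
  ultimately show ?thesis by blast
qed

text \<open>
  A conditional expectation has the same mean as the indicator itself.
\<close>

lemma emeasure_long_range_edges:
  assumes F: "finite F" "\<And>x y. (x, y) \<in> F \<Longrightarrow> x \<noteq> y" "inj_on (\<lambda>(x, y). {x, y}) F"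
  shows "emeasure M {\<omega> \<in> space M. \<forall>(x, y)\<in>F. {x, y} \<in> L \<omega>}
    = (\<integral>\<^sup>+\<omega>. ennreal (\<Prod>(x, y)\<in>F. connection_prob \<alpha> lam (\<lambda>v. W v \<omega>) x y) \<partial>M)"
proof -
  define G where "G = vimage_algebra (space M) (\<lambda>\<omega> x. W x \<omega>) (\<Pi>\<^sub>M x\<in>(UNIV :: (int ^ 'd) set). borel :: real measure)"
  have "(\<lambda>\<omega> x. W x \<omega>) \<in> measurable M (\<Pi>\<^sub>M x\<in>(UNIV :: (int ^ 'd) set). borel :: real measure)"
    by (rule measurable_PiM_single') (auto simp: PiE_def)
  then have "sets G \<subseteq> events"
    unfolding G_def by (intro sets_image_in_sets) auto
  then have "finite_measure_subalgebra M G"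
    by unfold_locales (auto simp: subalgebra_def G_def)
  then interpret G: sigma_finite_subalgebra M G
    by (rule finite_measure_subalgebra_is_sigma_finite)
  define E where "E = {\<omega> \<in> space M. \<forall>(x, y)\<in>F. {x, y} \<in> L \<omega>}"
  have "E = {\<omega> \<in> space M. \<forall>z\<in>F. {fst z, snd z} \<in> L \<omega>}" by (auto simp: E_def)
  also have "\<dots> \<in> events"
    using F(1) by (intro sets.sets_Collect_finite_All long_range_measurable)
  finally have E: "E \<in> events" .
  then have int: "integrable M (indicator E :: 'a \<Rightarrow> real)"
    by (intro integrable_real_indicator) (auto simp: emeasure_eq_measure)
  define P where "P \<omega> = (\<Prod>(x, y)\<in>F. connection_prob \<alpha> lam (\<lambda>v. W v \<omega>) x y)" for \<omega>
  have P: "P \<in> borel_measurable M"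
    unfolding P_def connection_prob_def case_prod_beta by measurable
  have ae: "AE \<omega> in M. real_cond_exp M G (indicator E) \<omega> = P \<omega>"
    using long_range_edges[OF F] unfolding G_def E_def P_def .
  have intP: "integrable M P"
    using integrable_cong_AE[OF _ P ae] G.real_cond_exp_int(1)[OF int] by simp
  have "ennreal (prob E) = ennreal (\<integral>\<omega>. indicator E \<omega> \<partial>M)" using E by simp
  also have "(\<integral>\<omega>. indicator E \<omega> \<partial>M) = (\<integral>\<omega>. real_cond_exp M G (indicator E) \<omega> \<partial>M)"
    using G.real_cond_exp_int(2)[OF int] by simp
  also have "\<dots> = (\<integral>\<omega>. P \<omega> \<partial>M)"
    by (intro integral_cong_AE ae P) simp
  also have "ennreal \<dots> = (\<integral>\<^sup>+\<omega>. ennreal (P \<omega>) \<partial>M)"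
  proof (rule nn_integral_eq_integral[symmetric, OF intP])
    have "AE \<omega> in M. 0 \<le> real_cond_exp M G (indicator E) \<omega>"
      by (intro G.real_cond_exp_pos) (use E in auto)
    with ae show "AE \<omega> in M. 0 \<le> P \<omega>" by eventually_elim simp
  qed
  finally show ?thesis by (simp add: E_def P_def emeasure_eq_measure)
qed

text \<open>
  Independence, for a family of distinct vertices that is indexed by a set of edges.
\<close>

lemma nn_integral_prod_weights_le:
  assumes m: "\<And>x. (\<integral>\<^sup>+\<omega>. ennreal (W x \<omega> powr s) \<partial>M) \<le> ennreal m"
    and F: "finite F" "inj_on f F" and "0 \<le> m"
  shows "(\<integral>\<^sup>+\<omega>. ennreal (\<Prod>z\<in>F. W (f z) \<omega> powr s) \<partial>M) \<le> ennreal (m ^ card F)"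
proof -
  have "(\<integral>\<^sup>+\<omega>. ennreal (\<Prod>z\<in>F. W (f z) \<omega> powr s) \<partial>M)
      = (\<integral>\<^sup>+\<omega>. (\<Prod>x\<in>f ` F. ennreal (W x \<omega> powr s)) \<partial>M)"
    using F by (simp add: prod.reindex prod_ennreal)
  also have "\<dots> = (\<Prod>x\<in>f ` F. \<integral>\<^sup>+\<omega>. ennreal (W x \<omega> powr s) \<partial>M)"
  proof (rule indep_vars_nn_integral)
    show "indep_vars (\<lambda>_. borel) (\<lambda>x \<omega>. ennreal (W x \<omega> powr s)) (f ` F)"
      by (rule indep_vars_compose2[OF indep_vars_subset[OF weights_indep]]) auto
  qed (use F in auto)
  also have "\<dots> \<le> (\<Prod>x\<in>f ` F. ennreal m)" by (intro prod_mono_ennreal m)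
  also have "\<dots> = ennreal (m ^ card F)"
    using F assms(4) by (simp add: card_image ennreal_power)
  finally show ?thesis .
qed

text \<open>
  On a self-avoiding path every vertex is the first end point of at most one edge and the second end
  point of at most one edge. Thus the product of the weights over the edges is \<open>X Y\<close>, where
  each of \<open>X\<close> and \<open>Y\<close> is a product of powers of the weights of distinct vertices. The inequality
  \<open>X Y \<le> (X\<^sup>2 + Y\<^sup>2) / 2\<close> removes the dependence between \<open>X\<close> and \<open>Y\<close> and costs only the moments of
  order \<open>2 \<beta>\<close>.
\<close>

lemma emeasure_edges_le_edge_weight:
  assumes \<beta>: "0 < \<beta>" "\<beta> \<le> \<alpha>" and lam: "0 < lam"
    and m: "1 \<le> m" "\<And>x. (\<integral>\<^sup>+\<omega>. ennreal (W x \<omega> powr (2 * \<beta>)) \<partial>M) \<le> ennreal m"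
    and p: "distinct p" and S: "distinct S" "set S \<subseteq> set (path_edges p)"
  shows "emeasure M {\<omega> \<in> space M. \<forall>(u, v)\<in>set S. {u, v} \<in> edges \<omega>}
    \<le> edge_weight (\<lambda>u v. ennreal (m * max 1 lam * eucl_dist u v powr - (\<beta> * real CARD('d)))) S"
proof -
  \<comment> \<open>Only edges of a length different from 1 have to be long-range edges.\<close>
  define F where "F = {z \<in> set S. eucl_dist (fst z) (snd z) \<noteq> 1}"
  have F: "finite F" "F \<subseteq> set (path_edges p)" "F \<subseteq> set S" using S by (auto simp: F_def)
  have noloop: "x \<noteq> y" if "(x, y) \<in> F" for x y using path_edges_no_loop[OF p] F that by blast
  define h where "h z = max 1 lam * eucl_dist (fst z) (snd z) powr - (\<beta> * real CARD('d))"
    for z :: "(int ^ 'd) \<times> (int ^ 'd)"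
  have h0: "0 \<le> h z" for z by (simp add: h_def)
  define X where "X \<omega> = (\<Prod>z\<in>F. W (fst z) \<omega> powr \<beta>)" for \<omega>
  define Y where "Y \<omega> = (\<Prod>z\<in>F. W (snd z) \<omega> powr \<beta>)" for \<omega>
  have [measurable]: "X \<in> borel_measurable M" "Y \<in> borel_measurable M"
    unfolding X_def Y_def by measurable
  define c :: real where "c = 1 / 2"
  have c: "0 \<le> c" "c + c = 1" by (simp_all add: c_def)
  have H0: "0 \<le> prod h F" by (intro prod_nonneg h0)
  have "{\<omega> \<in> space M. \<forall>(u, v)\<in>set S. {u, v} \<in> edges \<omega>}
      \<subseteq> {\<omega> \<in> space M. \<forall>(x, y)\<in>F. {x, y} \<in> L \<omega>}"
    unfolding F_def edges_def grid_edges_def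
    by (auto simp: doubleton_eq_iff eucl_dist_commute)
  moreover have "{\<omega> \<in> space M. \<forall>z\<in>F. {fst z, snd z} \<in> L \<omega>} \<in> events"
    using F(1) by (intro sets.sets_Collect_finite_All long_range_measurable)
  ultimately have "emeasure M {\<omega> \<in> space M. \<forall>(u, v)\<in>set S. {u, v} \<in> edges \<omega>}
      \<le> emeasure M {\<omega> \<in> space M. \<forall>(x, y)\<in>F. {x, y} \<in> L \<omega>}"
    by (intro emeasure_mono) (auto simp: case_prod_beta)
  also have "\<dots> = (\<integral>\<^sup>+\<omega>. ennreal (\<Prod>(x, y)\<in>F. connection_prob \<alpha> lam (\<lambda>v. W v \<omega>) x y) \<partial>M)"
    using F noloop inj_on_subset[OF path_edges_doubleton_inj[OF p] F(2)]
    by (intro emeasure_long_range_edges)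
  also have "\<dots> \<le> (\<integral>\<^sup>+\<omega>. ennreal (prod h F) * (ennreal c * ennreal ((X \<omega>)\<^sup>2)
      + ennreal c * ennreal ((Y \<omega>)\<^sup>2)) \<partial>M)"
  proof (rule nn_integral_mono_AE)
    have "AE \<omega> in M. \<forall>z\<in>F. 1 \<le> W (fst z) \<omega> \<and> 1 \<le> W (snd z) \<omega>"
      using F(1) by (intro AE_finite_allI AE_conjI weights_ge_1)
    then show "AE \<omega> in M. ennreal (\<Prod>(x, y)\<in>F. connection_prob \<alpha> lam (\<lambda>v. W v \<omega>) x y)
      \<le> ennreal (prod h F) * (ennreal c * ennreal ((X \<omega>)\<^sup>2) + ennreal c * ennreal ((Y \<omega>)\<^sup>2))"
    proof eventually_elim
      fix \<omega> assume w: "\<forall>z\<in>F. 1 \<le> W (fst z) \<omega> \<and> 1 \<le> W (snd z) \<omega>"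
      have "(\<Prod>(x, y)\<in>F. connection_prob \<alpha> lam (\<lambda>v. W v \<omega>) x y)
          \<le> (\<Prod>z\<in>F. h z * (W (fst z) \<omega> powr \<beta> * W (snd z) \<omega> powr \<beta>))"
      proof (rule prod_mono)
        fix z assume z: "z \<in> F"
        have "connection_prob \<alpha> lam (\<lambda>v. W v \<omega>) (fst z) (snd z)
          \<le> h z * (W (fst z) \<omega> powr \<beta> * W (snd z) \<omega> powr \<beta>)"
          unfolding h_def using w z noloop[of "fst z" "snd z"] \<beta> lam
          by (intro connection_prob_le) auto
        moreover have "0 \<le> connection_prob \<alpha> lam (\<lambda>v. W v \<omega>) (fst z) (snd z)"
          using lam by (simp add: connection_prob_def)
        ultimately show "0 \<le> (case z of (x, y) \<Rightarrow> connection_prob \<alpha> lam (\<lambda>v. W v \<omega>) x y)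
          \<and> (case z of (x, y) \<Rightarrow> connection_prob \<alpha> lam (\<lambda>v. W v \<omega>) x y)
            \<le> h z * (W (fst z) \<omega> powr \<beta> * W (snd z) \<omega> powr \<beta>)"
          by (simp add: case_prod_beta)
      qed
      also have "\<dots> = prod h F * (X \<omega> * Y \<omega>)"
        by (simp add: X_def Y_def prod.distrib)
      also have "\<dots> \<le> prod h F * (c * (X \<omega>)\<^sup>2 + c * (Y \<omega>)\<^sup>2)"
        using sum_squares_bound[of "X \<omega>" "Y \<omega>"] by (intro mult_left_mono H0) (simp add: c_def)
      finally have "ennreal (\<Prod>(x, y)\<in>F. connection_prob \<alpha> lam (\<lambda>v. W v \<omega>) x y)
        \<le> ennreal (prod h F * (c * (X \<omega>)\<^sup>2 + c * (Y \<omega>)\<^sup>2))" by (rule ennreal_leI)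
      also have "\<dots> = ennreal (prod h F) * (ennreal c * ennreal ((X \<omega>)\<^sup>2)
          + ennreal c * ennreal ((Y \<omega>)\<^sup>2))"
        using H0 c(1) by (simp add: ennreal_mult)
      finally show "ennreal (\<Prod>(x, y)\<in>F. connection_prob \<alpha> lam (\<lambda>v. W v \<omega>) x y)
        \<le> ennreal (prod h F) * (ennreal c * ennreal ((X \<omega>)\<^sup>2) + ennreal c * ennreal ((Y \<omega>)\<^sup>2))" .
    qed
  qed
  also have "\<dots> = ennreal (prod h F) * (ennreal c * (\<integral>\<^sup>+\<omega>. ennreal ((X \<omega>)\<^sup>2) \<partial>M)
      + ennreal c * (\<integral>\<^sup>+\<omega>. ennreal ((Y \<omega>)\<^sup>2) \<partial>M))"
    by (simp add: nn_integral_cmult nn_integral_add)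
  also have "\<dots> \<le> ennreal (prod h F) * (ennreal c * ennreal (m ^ card F)
      + ennreal c * ennreal (m ^ card F))"
  proof -
    have sq: "(w powr \<beta>)\<^sup>2 = w powr (2 * \<beta>)" for w :: real
      by (simp add: power2_eq_square flip: powr_add)
    have "(\<integral>\<^sup>+\<omega>. ennreal ((X \<omega>)\<^sup>2) \<partial>M) \<le> ennreal (m ^ card F)"
      unfolding X_def prod_power_distrib sq
      using m F inj_on_subset[OF path_edges_fst_inj[OF p] F(2)]
      by (intro nn_integral_prod_weights_le) auto
    moreover have "(\<integral>\<^sup>+\<omega>. ennreal ((Y \<omega>)\<^sup>2) \<partial>M) \<le> ennreal (m ^ card F)"
      unfolding Y_def prod_power_distrib sq
      using m F inj_on_subset[OF path_edges_snd_inj[OF p] F(2)]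
      by (intro nn_integral_prod_weights_le) auto
    ultimately show ?thesis by (intro mult_left_mono add_mono) auto
  qed
  also have "\<dots> = ennreal (\<Prod>z\<in>F. m * h z)"
    using m(1) H0 c by (simp add: prod.distrib mult.commute
        flip: ennreal_mult ennreal_plus distrib_right)
  also have "\<dots> \<le> ennreal (\<Prod>z\<in>set S. m * h z)"
  proof (intro ennreal_leI prod_mono2)
    \<comment> \<open>A unit edge has weight at least 1 and may be put back into the product.\<close>
    fix z assume "z \<in> set S - F"
    then have "m * h z = m * max 1 lam" by (auto simp: F_def h_def)
    moreover have "1 * 1 \<le> m * max 1 lam" using m(1) by (intro mult_mono) auto
    ultimately show "1 \<le> m * h z" by (simp only:)
  qed (use F m h0 in auto)
  also have "\<dots> = (\<Prod>z\<in>set S. ennreal (m * h z))"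
    using m h0 by (intro prod_ennreal[symmetric]) auto
  also have "\<dots> = edge_weight (\<lambda>u v. ennreal (m * max 1 lam * eucl_dist u v powr - (\<beta> * real CARD('d)))) S"
    unfolding edge_weight_def prod.distinct_set_conv_list[OF S(1)]
    by (simp add: h_def case_prod_unfold mult.assoc)
  finally show ?thesis .
qed

lemma edges_event_measurable: "{\<omega> \<in> space M. \<forall>(u, v)\<in>set S. {u, v} \<in> edges \<omega>} \<in> events"
proof -
  have "{\<omega> \<in> space M. e \<in> edges \<omega>} \<in> events" for e
    using long_range_measurable[of e] by (cases "e \<in> grid_edges") (auto simp: edges_def)
  then have "{\<omega> \<in> space M. \<forall>z\<in>set S. {fst z, snd z} \<in> edges \<omega>} \<in> events"
    by (intro sets.sets_Collect_finite_All) auto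
  then show ?thesis by (simp add: case_prod_beta)
qed

text \<open>
  If a path is present, so is its skeleton. The skeletons that belong to no self-avoiding path are
  discarded, since the product bound \<open>q\<close> is available only along such paths.
\<close>

lemma emeasure_path_le_total_weight:
  assumes SS: "skeletons j x y SS"
    and q: "\<And>p S. distinct p \<Longrightarrow> distinct S \<Longrightarrow> set S \<subseteq> set (path_edges p) \<Longrightarrow>
      emeasure M {\<omega> \<in> space M. \<forall>(u, v)\<in>set S. {u, v} \<in> edges \<omega>} \<le> edge_weight q S"
  shows "emeasure M {\<omega> \<in> space M. \<exists>p. is_path (edges \<omega>) x y p \<and> length p = Suc j}
    \<le> total_weight q SS"
proof -
  define ev where "ev S = {\<omega> \<in> space M. \<forall>(u, v)\<in>set S. {u, v} \<in> edges \<omega>}" for S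
  have ev: "ev S \<in> events" for S unfolding ev_def by (rule edges_event_measurable)
  define TT where "TT = {S \<in> SS. \<exists>p. distinct p \<and> subseq S (path_edges p)}"
  have "{\<omega> \<in> space M. \<exists>p. is_path (edges \<omega>) x y p \<and> length p = Suc j} \<subseteq> (\<Union>S\<in>TT. ev S)"
  proof safe
    fix \<omega> p assume \<omega>: "\<omega> \<in> space M" and p: "is_path (edges \<omega>) x y p" "length p = Suc j"
    then obtain S where S: "S \<in> SS" "subseq S (path_edges p)"
      using SS by (auto simp: skeletons_def is_path_def)
    moreover have "distinct p" using p by (simp add: is_path_def)
    ultimately have "S \<in> TT" by (auto simp: TT_def)
    moreover have "set S \<subseteq> set (path_edges p)" using S(2) by (auto dest: list_emb_set)
    then have "\<omega> \<in> ev S"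
      using p(1) \<omega> unfolding ev_def is_path_def successively_iff_path_edges by blast
    ultimately show "\<omega> \<in> (\<Union>S\<in>TT. ev S)" by blast
  qed
  then have "emeasure M {\<omega> \<in> space M. \<exists>p. is_path (edges \<omega>) x y p \<and> length p = Suc j}
      \<le> emeasure M (\<Union>S\<in>TT. ev S)"
    using ev by (intro emeasure_mono) auto
  also have "\<dots> \<le> (\<integral>\<^sup>+S. emeasure M (ev S) \<partial>count_space TT)"
    using ev by (intro emeasure_UN_le_nn_integral) auto
  also have "\<dots> \<le> (\<integral>\<^sup>+S. edge_weight q S \<partial>count_space TT)"
  proof (rule nn_integral_mono)
    fix S assume "S \<in> space (count_space TT)"
    then obtain p where p: "distinct p" "subseq S (path_edges p)" by (auto simp: TT_def)
    then have "set S \<subseteq> set (path_edges p)" by (auto dest: list_emb_set)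
    moreover have "distinct S"
      using p(2) distinct_path_edges[OF p(1)] by (auto simp: subseq_conv_nths intro: distinct_nthsI)
    ultimately show "emeasure M (ev S) \<le> edge_weight q S" unfolding ev_def using q p(1) by blast
  qed
  also have "\<dots> \<le> total_weight q SS"
    unfolding total_weight_def TT_def
    by (auto simp: nn_integral_count_space_indicator indicator_def intro!: nn_integral_mono)
  finally show ?thesis .
qed

end

section \<open>Paths of small cost\<close>

lemma nn_integral_exponential_density: "0 < l \<Longrightarrow> (\<integral>\<^sup>+x. ennreal (exponential_density l x) \<partial>lborel) = 1"
  using prob_space.emeasure_space_1[OF prob_space_exponential_density[of l]]
  by (simp add: emeasure_density)

context fpp_on_sfp
begin

lemma costs_measurable: "e \<in> vertex_pairs \<Longrightarrow> C e \<in> borel_measurable M"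
  using costs_indep by (simp add: indep_vars_def)

lemma cost_laplace_transform:
  assumes "e \<in> vertex_pairs" and "0 < \<mu>"
  shows "(\<integral>\<^sup>+\<omega>. ennreal (exp (- \<mu> * C e \<omega>)) \<partial>M) = ennreal (1 / (1 + \<mu>))"
proof -
  have "(\<integral>\<^sup>+\<omega>. ennreal (exp (- \<mu> * C e \<omega>)) \<partial>M)
      = (\<integral>\<^sup>+x. ennreal (exponential_density 1 x) * ennreal (exp (- \<mu> * x)) \<partial>lborel)"
    by (rule distributed_nn_integral[symmetric, OF costs_distr[OF assms(1)]]) simp
  also have "\<dots> = (\<integral>\<^sup>+x. ennreal (1 / (1 + \<mu>)) * ennreal (exponential_density (1 + \<mu>) x) \<partial>lborel)"
  proof (intro nn_integral_cong)
    fix x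
    show "ennreal (exponential_density 1 x) * ennreal (exp (- \<mu> * x))
        = ennreal (1 / (1 + \<mu>)) * ennreal (exponential_density (1 + \<mu>) x)"
    proof (cases "x < 0")
      case False
      have "exp (- x) * exp (- \<mu> * x) = exp (- x * (1 + \<mu>))"
        by (simp add: exp_add[symmetric] algebra_simps)
      also have "\<dots> = 1 / (1 + \<mu>) * ((1 + \<mu>) * exp (- x * (1 + \<mu>)))"
        using assms(2) by simp
      finally show ?thesis
        using False assms(2) by (simp add: exponential_density_def flip: ennreal_mult)
    qed (simp add: exponential_density_def)
  qed
  also have "\<dots> = ennreal (1 / (1 + \<mu>))"
    using assms(2) by (simp add: nn_integral_cmult nn_integral_exponential_density)
  finally show ?thesis .
qed

text \<open>
  The edges of a self-avoiding path are distinct as unordered pairs, so that their costs are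
  independent variables.
\<close>

lemma path_cost_eq_sum:
  assumes "distinct p"
  shows "path_cost c p = (\<Sum>e\<in>(\<lambda>(u, v). {u, v}) ` set (path_edges p). c e)"
proof -
  have "path_cost c p = (\<Sum>(u, v)\<leftarrow>path_edges p. c {u, v})"
    by (simp add: path_cost_def path_edges_def)
  also have "\<dots> = (\<Sum>(u, v)\<in>set (path_edges p). c {u, v})"
    using distinct_path_edges[OF assms] by (simp add: sum_list_distinct_conv_sum_set)
  also have "\<dots> = (\<Sum>e\<in>(\<lambda>(u, v). {u, v}) ` set (path_edges p). c e)"
    by (subst sum.reindex[OF path_edges_doubleton_inj[OF assms]]) (simp add: case_prod_beta comp_def)
  finally show ?thesis .
qed

lemma path_cost_measurable:
  assumes "distinct p"
  shows "(\<lambda>\<omega>. path_cost (\<lambda>e. C e \<omega>) p) \<in> borel_measurable M"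
  unfolding path_cost_eq_sum[OF assms]
  using path_edges_vertex_pairs[OF assms]
  by (intro borel_measurable_sum costs_measurable) (rule subsetD)

text \<open>
  Chernoff's bound: Markov's inequality for \<open>exp (\<mu> (t - cost))\<close>, whose expectation factorizes.
\<close>

lemma emeasure_path_cost_less_le:
  assumes p: "distinct p" and \<mu>: "0 < \<mu>"
  shows "emeasure M {\<omega> \<in> space M. path_cost (\<lambda>e. C e \<omega>) p < t}
    \<le> ennreal (exp (\<mu> * t) * (1 / (1 + \<mu>)) ^ (length p - 1))"
proof -
  define B where "B = (\<lambda>(u, v). {u, v}) ` set (path_edges p)"
  have B: "finite B" "B \<subseteq> vertex_pairs"
    unfolding B_def using path_edges_vertex_pairs[OF p] by auto
  have card: "card B = length p - 1"
    unfolding B_def card_image[OF path_edges_doubleton_inj[OF p]]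
    using distinct_card[OF distinct_path_edges[OF p]] by simp
  note pc = path_cost_measurable[OF p, measurable]
  have "emeasure M {\<omega> \<in> space M. path_cost (\<lambda>e. C e \<omega>) p < t}
      = (\<integral>\<^sup>+\<omega>. indicator {\<omega> \<in> space M. path_cost (\<lambda>e. C e \<omega>) p < t} \<omega> \<partial>M)"
    by (subst nn_integral_indicator) (auto intro: borel_measurable_less)
  also have "\<dots> \<le> (\<integral>\<^sup>+\<omega>. ennreal (exp (\<mu> * t)) * (\<Prod>e\<in>B. ennreal (exp (- \<mu> * C e \<omega>))) \<partial>M)"
  proof (rule nn_integral_mono)
    fix \<omega>
    have "(\<Prod>e\<in>B. ennreal (exp (- \<mu> * C e \<omega>))) = ennreal (exp (- \<mu> * path_cost (\<lambda>e. C e \<omega>) p))"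
      unfolding path_cost_eq_sum[OF p] B_def[symmetric]
      using B(1) by (simp add: prod_ennreal exp_sum[symmetric] sum_distrib_left)
    then have eq: "ennreal (exp (\<mu> * t)) * (\<Prod>e\<in>B. ennreal (exp (- \<mu> * C e \<omega>)))
        = ennreal (exp (\<mu> * (t - path_cost (\<lambda>e. C e \<omega>) p)))"
      by (simp add: exp_add[symmetric] algebra_simps flip: ennreal_mult)
    show "indicator {\<omega> \<in> space M. path_cost (\<lambda>e. C e \<omega>) p < t} \<omega>
        \<le> ennreal (exp (\<mu> * t)) * (\<Prod>e\<in>B. ennreal (exp (- \<mu> * C e \<omega>)))"
      unfolding eq using \<mu> by (auto simp: indicator_def simp flip: ennreal_1 intro!: ennreal_leI)
  qed
  also have "\<dots> = ennreal (exp (\<mu> * t)) * (\<integral>\<^sup>+\<omega>. (\<Prod>e\<in>B. ennreal (exp (- \<mu> * C e \<omega>))) \<partial>M)"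
    using B by (intro nn_integral_cmult borel_measurable_prod_ennreal measurable_compose[OF costs_measurable]) auto
  also have "(\<integral>\<^sup>+\<omega>. (\<Prod>e\<in>B. ennreal (exp (- \<mu> * C e \<omega>))) \<partial>M)
      = (\<Prod>e\<in>B. \<integral>\<^sup>+\<omega>. ennreal (exp (- \<mu> * C e \<omega>)) \<partial>M)"
  proof (rule indep_vars_nn_integral)
    show "indep_vars (\<lambda>_. borel) (\<lambda>e \<omega>. ennreal (exp (- \<mu> * C e \<omega>))) B"
      by (rule indep_vars_compose2[OF indep_vars_subset[OF costs_indep B(2)]]) auto
  qed (use B in auto)
  also have "\<dots> = (\<Prod>e\<in>B. ennreal (1 / (1 + \<mu>)))"
    using B \<mu> by (intro prod.cong cost_laplace_transform) auto
  also have "ennreal (exp (\<mu> * t)) * \<dots> = ennreal (exp (\<mu> * t) * (1 / (1 + \<mu>)) ^ (length p - 1))"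
    using \<mu> by (simp add: card ennreal_power flip: ennreal_mult)
  finally show ?thesis .
qed

lemma prob_edges_and_cost:
  assumes p: "distinct p"
  shows "prob {\<omega> \<in> space M. (\<forall>(u, v)\<in>set (path_edges p). {u, v} \<in> edges \<omega>)
      \<and> path_cost (\<lambda>e. C e \<omega>) p < t}
    = prob {\<omega> \<in> space M. \<forall>(u, v)\<in>set (path_edges p). {u, v} \<in> edges \<omega>}
      * prob {\<omega> \<in> space M. path_cost (\<lambda>e. C e \<omega>) p < t}"
proof -
  define B where "B = (\<lambda>(u, v). {u, v}) ` set (path_edges p)"
  have B: "finite B" "B \<subseteq> vertex_pairs"
    unfolding B_def using path_edges_vertex_pairs[OF p] by auto
  define G where "G = vimage_algebra (space M) (\<lambda>\<omega>. \<lambda>e\<in>vertex_pairs. e \<in> edges \<omega>)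
    (\<Pi>\<^sub>M e\<in>vertex_pairs. count_space UNIV)"
  define H where "H = vimage_algebra (space M) (\<lambda>\<omega>. \<lambda>e\<in>vertex_pairs. C e \<omega>)
    (\<Pi>\<^sub>M e\<in>vertex_pairs. borel)"
  have "(\<lambda>\<omega>. \<lambda>e\<in>vertex_pairs. e \<in> edges \<omega>) \<in> measurable G (\<Pi>\<^sub>M e\<in>vertex_pairs. count_space UNIV)"
    unfolding G_def by (rule measurable_vimage_algebra1) (auto simp: space_PiM)
  then have gm: "(\<lambda>\<omega>. (\<lambda>e\<in>vertex_pairs. e \<in> edges \<omega>) e) \<in> measurable G (count_space UNIV)"
    if "e \<in> vertex_pairs" for e
    by (rule measurable_compose[OF _ measurable_component_singleton[OF that]])
  have "(\<lambda>\<omega>. \<lambda>e\<in>vertex_pairs. C e \<omega>) \<in> measurable H (\<Pi>\<^sub>M e\<in>vertex_pairs. borel)"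
    unfolding H_def by (rule measurable_vimage_algebra1) (auto simp: space_PiM)
  then have hm: "(\<lambda>\<omega>. (\<lambda>e\<in>vertex_pairs. C e \<omega>) e) \<in> measurable H borel"
    if "e \<in> vertex_pairs" for e
    by (rule measurable_compose[OF _ measurable_component_singleton[OF that]])
  have "{\<omega> \<in> space G. \<forall>e\<in>B. e \<in> edges \<omega>} \<in> sets G"
  proof (intro sets.sets_Collect_finite_All B(1))
    fix e assume "e \<in> B"
    then have "e \<in> vertex_pairs" using B by auto
    then show "{\<omega> \<in> space G. e \<in> edges \<omega>} \<in> sets G"
      using gm[of e] by (simp add: pred_def)
  qed
  then have 1: "{\<omega> \<in> space M. \<forall>(u, v)\<in>set (path_edges p). {u, v} \<in> edges \<omega>} \<in> sets G"
    by (simp add: B_def G_def case_prod_beta)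
  have hm': "C e \<in> borel_measurable H" if "e \<in> B" for e
    using hm[of e] B that by (auto simp: subset_iff)
  have "(\<lambda>\<omega>. path_cost (\<lambda>e. C e \<omega>) p) \<in> borel_measurable H"
    unfolding path_cost_eq_sum[OF p] B_def[symmetric] by (intro borel_measurable_sum hm')
  then have "{\<omega> \<in> space H. path_cost (\<lambda>e. C e \<omega>) p < t} \<in> sets H"
    by measurable
  then have 2: "{\<omega> \<in> space M. path_cost (\<lambda>e. C e \<omega>) p < t} \<in> sets H"
    by (simp add: H_def)
  have eq: "{\<omega> \<in> space M. (\<forall>(u, v)\<in>set (path_edges p). {u, v} \<in> edges \<omega>)
      \<and> path_cost (\<lambda>e. C e \<omega>) p < t}
    = {\<omega> \<in> space M. \<forall>(u, v)\<in>set (path_edges p). {u, v} \<in> edges \<omega>}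
      \<inter> {\<omega> \<in> space M. path_cost (\<lambda>e. C e \<omega>) p < t}" by auto
  show ?thesis
    unfolding eq by (rule indep_setD[OF costs_indep_graph[folded G_def H_def] 1 2])
qed

lemma cheap_path_measurable:
  assumes p: "distinct p"
  shows "{\<omega> \<in> space M. (\<forall>(u, v)\<in>set (path_edges p). {u, v} \<in> edges \<omega>)
    \<and> path_cost (\<lambda>e. C e \<omega>) p < t} \<in> events"
proof -
  note path_cost_measurable[OF p, measurable]
  have "{\<omega> \<in> space M. path_cost (\<lambda>e. C e \<omega>) p < t} \<in> events" by measurable
  then show ?thesis by (intro sets.sets_Collect_conj edges_event_measurable)
qed

text \<open>
  First moment over all paths with \<open>j\<close> edges that start at \<open>x\<close>; for a single path, being present and
  being cheap are independent.
\<close>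

lemma emeasure_cheap_path_le:
  assumes \<mu>: "0 < \<mu>"
    and Q: "\<And>x. (\<integral>\<^sup>+y. q x y \<partial>count_space UNIV) \<le> Q"
    and q: "\<And>p S. distinct p \<Longrightarrow> distinct S \<Longrightarrow> set S \<subseteq> set (path_edges p) \<Longrightarrow>
      emeasure M {\<omega> \<in> space M. \<forall>(u, v)\<in>set S. {u, v} \<in> edges \<omega>} \<le> edge_weight q S"
  shows "emeasure M {\<omega> \<in> space M. \<exists>p. is_path (edges \<omega>) x y p \<and> length p = Suc j
      \<and> path_cost (\<lambda>e. C e \<omega>) p < t}
    \<le> Q ^ j * ennreal (exp (\<mu> * t) * (1 / (1 + \<mu>)) ^ j)"
proof -
  define ev where "ev p = {\<omega> \<in> space M. (\<forall>(u, v)\<in>set (path_edges p). {u, v} \<in> edges \<omega>)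
    \<and> path_cost (\<lambda>e. C e \<omega>) p < t}" for p
  define P where "P = {p. distinct p \<and> length p = Suc j \<and> hd p = x}"
  have ev: "ev p \<in> events" if "p \<in> P" for p
    using that unfolding ev_def P_def by (auto intro: cheap_path_measurable)
  have "{\<omega> \<in> space M. \<exists>p. is_path (edges \<omega>) x y p \<and> length p = Suc j
      \<and> path_cost (\<lambda>e. C e \<omega>) p < t} \<subseteq> (\<Union>p\<in>P. ev p)"
    by (auto simp: is_path_def P_def ev_def successively_iff_path_edges)
  then have "emeasure M {\<omega> \<in> space M. \<exists>p. is_path (edges \<omega>) x y p \<and> length p = Suc j
      \<and> path_cost (\<lambda>e. C e \<omega>) p < t} \<le> emeasure M (\<Union>p\<in>P. ev p)"
    using ev by (intro emeasure_mono sets.countable_UN'') auto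
  also have "\<dots> \<le> (\<integral>\<^sup>+p. emeasure M (ev p) \<partial>count_space P)"
    using ev by (intro emeasure_UN_le_nn_integral) auto
  also have "\<dots> \<le> (\<integral>\<^sup>+p. edge_weight q (path_edges p) * ennreal (exp (\<mu> * t) * (1 / (1 + \<mu>)) ^ j) \<partial>count_space P)"
  proof (rule nn_integral_mono)
    fix p assume "p \<in> space (count_space P)"
    then have p: "distinct p" "length p = Suc j" by (auto simp: P_def)
    have "emeasure M (ev p)
      = emeasure M {\<omega> \<in> space M. \<forall>(u, v)\<in>set (path_edges p). {u, v} \<in> edges \<omega>}
        * emeasure M {\<omega> \<in> space M. path_cost (\<lambda>e. C e \<omega>) p < t}"
      unfolding ev_def emeasure_eq_measure prob_edges_and_cost[OF p(1)] by (simp add: ennreal_mult)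
    also have "\<dots> \<le> edge_weight q (path_edges p) * ennreal (exp (\<mu> * t) * (1 / (1 + \<mu>)) ^ j)"
      using q[OF p(1) distinct_path_edges[OF p(1)]] emeasure_path_cost_less_le[OF p(1) \<mu>, of t] p(2)
      by (intro mult_mono) auto
    finally show "emeasure M (ev p)
      \<le> edge_weight q (path_edges p) * ennreal (exp (\<mu> * t) * (1 / (1 + \<mu>)) ^ j)" .
  qed
  also have "\<dots> = (\<integral>\<^sup>+p. edge_weight q (path_edges p) \<partial>count_space P)
      * ennreal (exp (\<mu> * t) * (1 / (1 + \<mu>)) ^ j)"
    by (simp add: nn_integral_multc)
  also have "(\<integral>\<^sup>+p. edge_weight q (path_edges p) \<partial>count_space P)
      \<le> (\<integral>\<^sup>+p. edge_weight q (path_edges p) \<partial>count_space {p. length p = Suc j \<and> hd p = x})"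
    unfolding P_def
    by (auto simp: nn_integral_count_space_indicator indicator_def intro!: nn_integral_mono)
  also have "\<dots> \<le> Q ^ j" by (rule total_weight_paths_le[OF Q])
  finally show ?thesis by (simp add: mult_right_mono)
qed

text \<open>
  Only countably many vertex lists exist, so all events about paths are countable unions of
  events about a single list.
\<close>

lemma path_event_measurable:
  "{\<omega> \<in> space M. is_path (edges \<omega>) x y p} \<in> events"
proof (cases "p \<noteq> [] \<and> hd p = x \<and> last p = y \<and> distinct p")
  case True
  then have "{\<omega> \<in> space M. is_path (edges \<omega>) x y p}
      = {\<omega> \<in> space M. \<forall>(u, v)\<in>set (path_edges p). {u, v} \<in> edges \<omega>}"
    by (simp add: is_path_def successively_iff_path_edges)
  then show ?thesis using edges_event_measurable by simp
next
  case False
  then have "{\<omega> \<in> space M. is_path (edges \<omega>) x y p} = {}" by (auto simp: is_path_def)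
  then show ?thesis by (simp only: sets.empty_sets)
qed

lemma some_path_event_measurable:
  "{\<omega> \<in> space M. \<exists>p. is_path (edges \<omega>) x y p \<and> R p} \<in> events"
proof -
  have "{\<omega> \<in> space M. \<exists>p. is_path (edges \<omega>) x y p \<and> R p}
      = (\<Union>p\<in>Collect R. {\<omega> \<in> space M. is_path (edges \<omega>) x y p})" by auto
  then show ?thesis
    using path_event_measurable by (simp only:) (intro sets.countable_UN'', auto)
qed

lemma some_cheap_path_event_measurable:
  "{\<omega> \<in> space M. \<exists>p. is_path (edges \<omega>) x y p \<and> R p \<and> path_cost (\<lambda>e. C e \<omega>) p < t} \<in> events"
proof -
  have "{\<omega> \<in> space M. is_path (edges \<omega>) x y p \<and> path_cost (\<lambda>e. C e \<omega>) p < t} \<in> events"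
    if "distinct p" for p
    by (intro sets.sets_Collect_conj path_event_measurable borel_measurable_less
        path_cost_measurable that) auto
  moreover have "{\<omega> \<in> space M. \<exists>p. is_path (edges \<omega>) x y p \<and> R p \<and> path_cost (\<lambda>e. C e \<omega>) p < t}
      = (\<Union>p\<in>{p. R p \<and> distinct p}.
          {\<omega> \<in> space M. is_path (edges \<omega>) x y p \<and> path_cost (\<lambda>e. C e \<omega>) p < t})"
    by (auto simp: is_path_def)
  ultimately show ?thesis by (simp only:) (intro sets.countable_UN'', auto)
qed

text \<open>
  Paths with at most \<open>k\<close> edges are counted by their skeletons, whatever their costs; paths with
  more edges are counted directly, because cheapness then costs a factor \<open>1 / 2\<close> for each edge.
\<close>

lemma emeasure_cost_less_le:
  assumes skel: "\<And>j. \<exists>SS. skeletons j x y SS \<and> total_weight q SS \<le> ennreal (g j)"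
    and g: "\<And>j. 0 \<le> g j"
    and \<mu>: "0 < \<mu>"
    and Q: "\<And>x. (\<integral>\<^sup>+y. q x y \<partial>count_space UNIV) \<le> ennreal Q" "0 \<le> Q" "2 * Q \<le> 1 + \<mu>"
    and q: "\<And>p S. distinct p \<Longrightarrow> distinct S \<Longrightarrow> set S \<subseteq> set (path_edges p) \<Longrightarrow>
      emeasure M {\<omega> \<in> space M. \<forall>(u, v)\<in>set S. {u, v} \<in> edges \<omega>} \<le> edge_weight q S"
  shows "emeasure M {\<omega> \<in> space M. \<exists>p. is_path (edges \<omega>) x y p \<and> path_cost (\<lambda>e. C e \<omega>) p < t}
    \<le> ennreal ((\<Sum>j\<le>k. g j) + exp (\<mu> * t) * (1 / 2) ^ k)"
proof -
  define A where "A j = {\<omega> \<in> space M. \<exists>p. is_path (edges \<omega>) x y p \<and> length p = Suc j}" for j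
  define B where "B j = {\<omega> \<in> space M. \<exists>p. is_path (edges \<omega>) x y p \<and> length p = Suc j
    \<and> path_cost (\<lambda>e. C e \<omega>) p < t}" for j
  have A: "A j \<in> events" for j unfolding A_def by (rule some_path_event_measurable)
  have B: "B j \<in> events" for j unfolding B_def by (rule some_cheap_path_event_measurable)
  have A_le: "emeasure M (A j) \<le> ennreal (g j)" for j
  proof -
    obtain SS where SS: "skeletons j x y SS" "total_weight q SS \<le> ennreal (g j)"
      using skel by blast
    show ?thesis
      unfolding A_def using emeasure_path_le_total_weight[OF SS(1) q] SS(2) by (rule order_trans)
  qed
  have B_le: "emeasure M (B j) \<le> ennreal (exp (\<mu> * t) * (1 / 2) ^ j)" for j
  proof -
    have "emeasure M (B j) \<le> ennreal Q ^ j * ennreal (exp (\<mu> * t) * (1 / (1 + \<mu>)) ^ j)"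
      unfolding B_def by (rule emeasure_cheap_path_le[OF \<mu> Q(1) q])
    also have "\<dots> = ennreal (exp (\<mu> * t) * (Q / (1 + \<mu>)) ^ j)"
      using Q \<mu> by (simp add: ennreal_power power_divide mult_ac flip: ennreal_mult)
    also have "\<dots> \<le> ennreal (exp (\<mu> * t) * (1 / 2) ^ j)"
      using Q \<mu> by (intro ennreal_leI mult_left_mono power_mono) (auto simp: field_simps)
    finally show ?thesis .
  qed
  have "{\<omega> \<in> space M. \<exists>p. is_path (edges \<omega>) x y p \<and> path_cost (\<lambda>e. C e \<omega>) p < t}
      \<subseteq> (\<Union>j\<in>{..k}. A j) \<union> (\<Union>n. B (Suc k + n))"
  proof safe
    fix \<omega> p assume \<omega>: "\<omega> \<in> space M" and p: "is_path (edges \<omega>) x y p"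
      "path_cost (\<lambda>e. C e \<omega>) p < t" and no: "\<omega> \<notin> (\<Union>n. B (Suc k + n))"
    obtain j where j: "length p = Suc j" using p(1) by (cases p) (auto simp: is_path_def)
    have "\<omega> \<in> A j" "\<omega> \<in> B j" using \<omega> p j by (auto simp: A_def B_def)
    moreover have "j \<le> k"
    proof (rule ccontr)
      assume "\<not> j \<le> k"
      then obtain n where "j = Suc k + n" by (metis not_less_eq_eq le_Suc_ex)
      then show False using no \<open>\<omega> \<in> B j\<close> by blast
    qed
    ultimately show "\<omega> \<in> (\<Union>j\<in>{..k}. A j)" by blast
  qed
  then have "emeasure M {\<omega> \<in> space M. \<exists>p. is_path (edges \<omega>) x y p \<and> path_cost (\<lambda>e. C e \<omega>) p < t}
      \<le> emeasure M ((\<Union>j\<in>{..k}. A j) \<union> (\<Union>n. B (Suc k + n)))"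
    using A B by (intro emeasure_mono) auto
  also have "\<dots> \<le> emeasure M (\<Union>j\<in>{..k}. A j) + emeasure M (\<Union>n. B (Suc k + n))"
    using A B by (intro emeasure_subadditive) auto
  also have "emeasure M (\<Union>j\<in>{..k}. A j) \<le> (\<Sum>j\<in>{..k}. emeasure M (A j))"
    using A by (intro emeasure_subadditive_finite) auto
  also have "\<dots> \<le> (\<Sum>j\<in>{..k}. ennreal (g j))" by (intro sum_mono A_le)
  also have "\<dots> = ennreal (\<Sum>j\<le>k. g j)" by (simp add: g sum_ennreal)
  also have "emeasure M (\<Union>n. B (Suc k + n)) \<le> (\<Sum>n. emeasure M (B (Suc k + n)))"
    using B by (intro emeasure_subadditive_countably) auto
  also have "\<dots> \<le> (\<Sum>n. ennreal (exp (\<mu> * t) * (1 / 2) ^ Suc k * (1 / 2) ^ n))"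
  proof (intro suminf_le)
    show "emeasure M (B (Suc k + n)) \<le> ennreal (exp (\<mu> * t) * (1 / 2) ^ Suc k * (1 / 2) ^ n)" for n
      using B_le[of "Suc k + n"] by (simp only: power_add mult.assoc)
  qed auto
  also have "\<dots> = ennreal (exp (\<mu> * t) * (1 / 2) ^ Suc k * (1 / (1 - 1 / 2)))"
    by (intro suminf_ennreal_eq sums_mult geometric_sums) auto
  also have "ennreal (\<Sum>j\<le>k. g j) + \<dots> = ennreal ((\<Sum>j\<le>k. g j) + exp (\<mu> * t) * (1 / 2) ^ k)"
    by (subst ennreal_plus[symmetric]) (auto simp: g sum_nonneg)
  finally show ?thesis by (simp add: add_mono)
qed

lemma prob_cost_dist_ge:
  "prob {\<omega> \<in> space M. ereal t \<le> cost_dist (edges \<omega>) (\<lambda>e. C e \<omega>) x y}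
    = 1 - prob {\<omega> \<in> space M. \<exists>p. is_path (edges \<omega>) x y p \<and> path_cost (\<lambda>e. C e \<omega>) p < t}"
proof -
  have "{\<omega> \<in> space M. \<exists>p. is_path (edges \<omega>) x y p \<and> path_cost (\<lambda>e. C e \<omega>) p < t} \<in> events"
    using some_cheap_path_event_measurable[of x y "\<lambda>_. True"] by simp
  moreover have "{\<omega> \<in> space M. ereal t \<le> cost_dist (edges \<omega>) (\<lambda>e. C e \<omega>) x y}
    = space M - {\<omega> \<in> space M. \<exists>p. is_path (edges \<omega>) x y p \<and> path_cost (\<lambda>e. C e \<omega>) p < t}"
    by (auto simp: cost_dist_def le_INF_iff not_less)
  ultimately show ?thesis by (simp add: prob_compl)
qed

end

section \<open>The lower bound for the cost distance\<close>

text \<open>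
  Here \<open>l\<close> is the logarithm of the distance. The number \<open>k\<close> of edges is chosen large enough that
  \<open>2\<^sup>-\<^sup>k\<close> beats \<open>exp (\<mu> t)\<close> for \<open>t = l\<^sup>a\<close>. As \<open>k\<^sup>\<rho>\<close> is of order \<open>l\<^sup>a\<^sup>\<rho>\<close>, which is
  sublinear, the factor \<open>exp (- s l)\<close> beats the weight of the skeletons.
\<close>

lemma error_bound_vanishes:
  fixes C \<sigma> s \<mu> a \<rho> :: real
  assumes pos: "0 < C" "0 < \<sigma>" "0 < s" "0 < \<mu>" "0 < a" "0 < \<rho>" and sub: "a * \<rho> < 1"
  defines "k \<equiv> \<lambda>l. nat \<lceil>4 * \<mu> * l powr a\<rceil>"
  shows "((\<lambda>l. (\<Sum>j\<le>k l. (exp (C * real j powr \<rho>) - 1) / \<sigma> * exp (- s * l))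
    + exp (\<mu> * l powr a) * (1 / 2) ^ k l) \<longlongrightarrow> 0) at_top"
proof -
  define K where "K = 4 * \<mu> + 1"
  define \<eta> where "\<eta> = a * \<rho>"
  define D where "D = C * K powr \<rho>"
  have K: "0 < K" using pos by (simp add: K_def)
  have \<eta>: "0 < \<eta>" "\<eta> < 1" using pos sub by (auto simp: \<eta>_def)
  have D: "0 < D" using pos K by (simp add: D_def)
  define h where "h l = (K + 1) / \<sigma> * (l powr a * exp (D * l powr \<eta> - s * l)) + exp (- \<mu> * l powr a)" for l
  have "((\<lambda>l. l powr a * exp (D * l powr \<eta> - s * l)) \<longlongrightarrow> 0) at_top"
    using D \<eta> pos by real_asymp
  moreover have "((\<lambda>l. exp (- \<mu> * l powr a)) \<longlongrightarrow> 0) at_top"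
    using pos by real_asymp
  ultimately have "(h \<longlongrightarrow> (K + 1) / \<sigma> * 0 + 0) at_top"
    unfolding h_def by (intro tendsto_add tendsto_mult tendsto_const)
  then have h: "(h \<longlongrightarrow> 0) at_top" by simp
  have bound: "(\<Sum>j\<le>k l. (exp (C * real j powr \<rho>) - 1) / \<sigma> * exp (- s * l))
      + exp (\<mu> * l powr a) * (1 / 2) ^ k l \<le> h l" if l: "1 \<le> l" for l
  proof -
    define t where "t = l powr a"
    have t: "1 \<le> t" using l pos by (auto simp: t_def intro: ge_one_powr_ge_zero)
    have k1: "4 * \<mu> * t \<le> real (k l)" unfolding k_def t_def by linarith
    have "0 < 4 * \<mu> * t" using pos t by simp
    then have k2: "real (k l) \<le> 4 * \<mu> * t + 1" unfolding k_def t_def by linarith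
    also have "\<dots> \<le> K * t" using t by (simp add: K_def algebra_simps)
    finally have kK: "real (k l) \<le> K * t" .
    have "(\<Sum>j\<le>k l. (exp (C * real j powr \<rho>) - 1) / \<sigma> * exp (- s * l))
        \<le> (\<Sum>j\<le>k l. exp (D * l powr \<eta>) / \<sigma> * exp (- s * l))"
    proof (intro sum_mono mult_right_mono divide_right_mono)
      fix j assume "j \<in> {..k l}"
      then have "real j \<le> K * t" using kK by simp
      then have "real j powr \<rho> \<le> (K * t) powr \<rho>" using pos by (intro powr_mono2) auto
      also have "\<dots> = K powr \<rho> * l powr \<eta>"
        using K l by (simp add: t_def powr_mult powr_powr \<eta>_def)
      finally have "C * real j powr \<rho> \<le> D * l powr \<eta>"
        using pos by (simp add: D_def mult.assoc)
      then have "exp (C * real j powr \<rho>) \<le> exp (D * l powr \<eta>)" by simp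
      then show "exp (C * real j powr \<rho>) - 1 \<le> exp (D * l powr \<eta>)" by linarith
    qed (use pos in auto)
    also have "\<dots> = (real (k l) + 1) * (exp (D * l powr \<eta> - s * l) / \<sigma>)"
      by (simp add: exp_diff exp_minus field_simps)
    also have "\<dots> \<le> ((K + 1) * t) * (exp (D * l powr \<eta> - s * l) / \<sigma>)"
      using kK t pos by (intro mult_right_mono) (auto simp: algebra_simps)
    also have "\<dots> = (K + 1) / \<sigma> * (l powr a * exp (D * l powr \<eta> - s * l))"
      by (simp add: t_def)
    finally have 1: "(\<Sum>j\<le>k l. (exp (C * real j powr \<rho>) - 1) / \<sigma> * exp (- s * l))
      \<le> (K + 1) / \<sigma> * (l powr a * exp (D * l powr \<eta> - s * l))" .
    have ln2: "1 / 2 \<le> ln (2 :: real)" using ln2_ge_two_thirds by simp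
    have "(1 / 2 :: real) ^ k l = exp (- ln 2 * real (k l))"
      using powr_realpow[of "1 / 2 :: real" "k l"] by (simp add: powr_def ln_div mult.commute)
    also have "\<dots> \<le> exp (- 2 * \<mu> * t)"
    proof -
      have "1 / 2 * (4 * \<mu> * t) \<le> ln 2 * real (k l)"
        using ln2 k1 pos t by (intro mult_mono) auto
      then show ?thesis by simp
    qed
    finally have "exp (\<mu> * t) * (1 / 2) ^ k l \<le> exp (\<mu> * t) * exp (- 2 * \<mu> * t)"
      by (intro mult_left_mono) auto
    also have "\<dots> = exp (- \<mu> * l powr a)" by (simp add: exp_add[symmetric] t_def)
    finally show ?thesis using 1 by (simp add: h_def t_def)
  qed
  show ?thesis
  proof (rule tendsto_sandwich[OF _ _ tendsto_const h])
    show "\<forall>\<^sub>F l in at_top. 0 \<le> (\<Sum>j\<le>k l. (exp (C * real j powr \<rho>) - 1) / \<sigma> * exp (- s * l))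
      + exp (\<mu> * l powr a) * (1 / 2) ^ k l"
      using pos by (intro always_eventually allI add_nonneg_nonneg sum_nonneg mult_nonneg_nonneg) auto
    show "\<forall>\<^sub>F l in at_top. (\<Sum>j\<le>k l. (exp (C * real j powr \<rho>) - 1) / \<sigma> * exp (- s * l))
      + exp (\<mu> * l powr a) * (1 / 2) ^ k l \<le> h l"
      using eventually_ge_at_top[of 1] by eventually_elim (rule bound)
  qed
qed

theorem corollary1p9:
  fixes M :: "'a measure"
    and W :: "int ^ 'd \<Rightarrow> 'a \<Rightarrow> real"
    and L :: "'a \<Rightarrow> (int ^ 'd) set set"
    and C :: "(int ^ 'd) set \<Rightarrow> 'a \<Rightarrow> real"
    and \<alpha> \<tau> lam :: real
  assumes "1 < \<alpha>" and "\<alpha> < 2" and "3 < \<tau>" and "0 < lam"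
    and "fpp_on_sfp M W L \<alpha> \<tau> lam C"
  shows "\<exists>\<epsilon>\<^sub>0>0. \<forall>\<epsilon>. 0 < \<epsilon> \<and> \<epsilon> < \<epsilon>\<^sub>0 \<longrightarrow>
    ((\<lambda>(x, y). measure M {\<omega> \<in> space M.
        ereal (ln (eucl_dist x y) powr Delta (min \<alpha> ((\<tau> - 1) / 2) - \<epsilon>))
          \<le> cost_dist (scale_free_percolation.edges L \<omega>) (\<lambda>e. C e \<omega>) x y})
      \<longlongrightarrow> 1) (filtercomap (\<lambda>(x, y). eucl_dist x y) at_top)"
proof (intro exI[of _ "min \<alpha> ((\<tau> - 1) / 2) - 1"] conjI allI impI)
  interpret fpp_on_sfp M W L \<alpha> \<tau> lam C by fact
  define \<gamma> where "\<gamma> = min \<alpha> ((\<tau> - 1) / 2)"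
  have \<gamma>: "1 < \<gamma>" "\<gamma> < 2" "\<gamma> \<le> \<alpha>" "2 * \<gamma> \<le> \<tau> - 1"
    using assms(1-3) unfolding \<gamma>_def by (auto simp: min_def field_simps)
  show "0 < min \<alpha> ((\<tau> - 1) / 2) - 1" using \<gamma>(1) by (simp add: \<gamma>_def)
  fix \<epsilon> assume "0 < \<epsilon> \<and> \<epsilon> < min \<alpha> ((\<tau> - 1) / 2) - 1"
  then have \<epsilon>: "0 < \<epsilon>" "\<epsilon> < \<gamma> - 1" by (auto simp: \<gamma>_def)
  define d where "d = real CARD('d)"
  have d: "0 < d" by (simp add: d_def)
  \<comment> \<open>Between \<open>b0\<close>, whose \<open>Delta\<close> is to be reached, and \<open>\<gamma>\<close> there is room for two further
    exponents: \<open>b1\<close> for the growth of the skeletons, which makes \<open>a \<rho> < 1\<close>, and \<open>\<beta>\<close> for the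
    decay of the connection probabilities.\<close>
  define b0 where "b0 = \<gamma> - \<epsilon>"
  define b1 where "b1 = \<gamma> - \<epsilon> * 2 / 3"
  define \<beta> where "\<beta> = \<gamma> - \<epsilon> / 3"
  have b: "1 < b0" "b0 < b1" "b1 < \<beta>" "\<beta> < \<gamma>" "1 < b1" "1 < \<beta>"
    using \<epsilon> by (auto simp: b0_def b1_def \<beta>_def)
  \<comment> \<open>Above \<open>1 / \<beta>\<close> the lattice sum with exponent \<open>\<theta> \<beta> d\<close> converges; below \<open>1 / b1\<close> the
    recursion closes.\<close>
  define \<theta> where "\<theta> = (1 / \<beta> + 1 / b1) / 2"
  have "1 / \<beta> < 1 / b1" using b by (intro divide_strict_left_mono) auto
  then have \<theta>': "1 / \<beta> < \<theta>" "\<theta> < 1 / b1" by (auto simp: \<theta>_def)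
  then have \<theta>: "0 < \<theta>" "1 < \<theta> * \<beta>" "\<theta> * b1 < 1"
    using b by (auto simp: field_simps intro: less_trans[of 0 "1 / \<beta>"])
  have "1 / b1 < 1" using b by simp
  then have \<theta>1: "\<theta> \<le> 1" using \<theta>' by linarith
  define \<rho> where "\<rho> = log 2 (2 / b1)"
  have \<rho>1: "2 powr (1 - \<rho>) = b1" using b by (simp add: \<rho>_def powr_diff)
  have \<rho>: "0 < \<rho>" "\<rho> < 1"
    using b \<gamma> by (auto simp: \<rho>_def log_less_iff divide_less_eq)
  define a where "a = Delta b0"
  have "\<rho> < log 2 (2 / b0)" unfolding \<rho>_def using b by (auto simp: divide_strict_left_mono)
  then have a: "0 < a" "a * \<rho> < 1" using \<rho> by (auto simp: a_def Delta_def)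
  define \<kappa> where "\<kappa> = \<beta> * d"
  have \<kappa>: "0 < \<kappa>" using b d by (simp add: \<kappa>_def)
  have s: "real CARD('d) < \<theta> * \<kappa>" "real CARD('d) < \<kappa>"
    using \<theta>(2) b d by (auto simp: \<kappa>_def d_def simp flip: mult.assoc)
  obtain \<sigma> where \<sigma>: "0 < \<sigma>"
    "\<And>x :: int ^ 'd. (\<integral>\<^sup>+y. ennreal (eucl_dist x y powr - (\<theta> * \<kappa>)) \<partial>count_space UNIV) \<le> ennreal \<sigma>"
    using lattice_powr_sum_bounded[OF s(1)] by blast
  obtain \<sigma>' where \<sigma>': "0 < \<sigma>'"
    "\<And>x :: int ^ 'd. (\<integral>\<^sup>+y. ennreal (eucl_dist x y powr - \<kappa>) \<partial>count_space UNIV) \<le> ennreal \<sigma>'"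
    using lattice_powr_sum_bounded[OF s(2)] by blast
  obtain m where m: "1 \<le> m" "\<And>x. (\<integral>\<^sup>+\<omega>. ennreal (W x \<omega> powr (2 * \<beta>)) \<partial>M) \<le> ennreal m"
    using weight_moments_bounded[of "2 * \<beta>"] b \<gamma> by auto
  define A where "A = m * max 1 lam"
  have A: "0 < A" using m by (simp add: A_def)
  define q where "q u v = ennreal (A * eucl_dist u v powr - \<kappa>)" for u v :: "int ^ 'd"
  have q: "emeasure M {\<omega> \<in> space M. \<forall>(u, v)\<in>set S. {u, v} \<in> edges \<omega>} \<le> edge_weight q S"
    if "distinct p" "distinct S" "set S \<subseteq> set (path_edges p)" for p S
    unfolding q_def A_def \<kappa>_def d_def
    using b \<gamma> assms(4) by (intro emeasure_edges_le_edge_weight[OF _ _ _ m that]) auto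
  define Q where "Q = A * \<sigma>'"
  have Q0: "0 < Q" using A \<sigma>' by (simp add: Q_def)
  have Q: "(\<integral>\<^sup>+y. q x y \<partial>count_space UNIV) \<le> ennreal Q" for x
  proof -
    have "(\<integral>\<^sup>+y. q x y \<partial>count_space UNIV)
        = ennreal A * (\<integral>\<^sup>+y. ennreal (eucl_dist x y powr - \<kappa>) \<partial>count_space UNIV)"
      unfolding q_def using A by (simp add: ennreal_mult nn_integral_cmult)
    also have "\<dots> \<le> ennreal A * ennreal \<sigma>'" by (intro mult_left_mono \<sigma>') auto
    finally show ?thesis using A \<sigma>' by (simp add: Q_def ennreal_mult)
  qed
  obtain c where c: "0 < c" "\<And>k. 0 < k \<Longrightarrow>
    (A * real k powr \<kappa> * (\<Sum>i<k. exp (c * real i powr \<rho>) * exp (c * real (k - 1 - i) powr \<rho>))) powr \<theta>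
      \<le> (exp (c * real k powr \<rho>) - 1) / \<sigma>"
    using stretched_exponential_recursion[OF A \<sigma>(1) \<kappa> \<theta>(1) \<rho>] \<theta>(3) unfolding \<rho>1 by blast
  define \<mu> where "\<mu> = 2 * Q"
  have \<mu>: "0 < \<mu>" using Q0 by (simp add: \<mu>_def)
  define k where "k l = nat \<lceil>4 * \<mu> * l powr a\<rceil>" for l
  define err where "err l = (\<Sum>j\<le>k l. (exp (c * real j powr \<rho>) - 1) / \<sigma> * exp (- (\<theta> * \<kappa>) * l))
    + exp (\<mu> * l powr a) * (1 / 2) ^ k l" for l
  have err: "(err \<longlongrightarrow> 0) at_top"
    unfolding err_def k_def using c \<sigma> \<theta> \<kappa> \<mu> a \<rho> by (intro error_bound_vanishes) auto
  have main: "1 - err (ln (eucl_dist x y)) \<le> prob {\<omega> \<in> space M.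
      ereal (ln (eucl_dist x y) powr a) \<le> cost_dist (edges \<omega>) (\<lambda>e. C e \<omega>) x y}"
    if xy: "x \<noteq> y" for x y
  proof -
    define l where "l = ln (eucl_dist x y)"
    have D: "1 \<le> eucl_dist x y" using xy by (rule eucl_dist_ge_1)
    define g where "g j = (exp (c * real j powr \<rho>) - 1) / \<sigma> * exp (- (\<theta> * \<kappa>) * l)" for j :: nat
    have g: "0 \<le> g j" for j using c \<sigma> by (simp add: g_def)
    have "\<exists>SS. skeletons j x y SS \<and> total_weight q SS \<le> ennreal (g j)" for j
    proof -
      have "eucl_dist x y powr - (\<theta> * \<kappa>) = exp (- (\<theta> * \<kappa>) * l)"
        using D by (simp add: powr_def l_def)
      then show ?thesis
        using skeletons_exist[where a = "\<lambda>j. exp (c * real j powr \<rho>)", OF A \<theta>(1) \<theta>1 \<sigma> _ \<kappa> c(2), of j x y]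
          c(1) xy unfolding q_def g_def by simp
    qed
    then have "emeasure M {\<omega> \<in> space M. \<exists>p. is_path (edges \<omega>) x y p
        \<and> path_cost (\<lambda>e. C e \<omega>) p < l powr a} \<le> ennreal (err l)"
      unfolding err_def g_def[symmetric]
      using g \<mu> Q Q0 q by (intro emeasure_cost_less_le) (auto simp: \<mu>_def)
    moreover have "0 \<le> err l"
      unfolding err_def g_def[symmetric] using g by (intro add_nonneg_nonneg sum_nonneg) auto
    ultimately show ?thesis
      unfolding prob_cost_dist_ge l_def[symmetric] by (simp add: emeasure_eq_measure)
  qed
  let ?F = "filtercomap (\<lambda>(x :: int ^ 'd, y). eucl_dist x y) at_top"
  let ?P = "\<lambda>(x, y). prob {\<omega> \<in> space M. ereal (ln (eucl_dist x y) powr a)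
      \<le> cost_dist (edges \<omega>) (\<lambda>e. C e \<omega>) x y}"
  have dist: "filterlim (\<lambda>(x :: int ^ 'd, y). eucl_dist x y) at_top ?F"
    by (rule filterlim_filtercomap)
  have "((\<lambda>z. 1 - err (ln (case z of (x, y) \<Rightarrow> eucl_dist x y))) \<longlongrightarrow> 1 - 0) ?F"
    by (intro tendsto_diff tendsto_const filterlim_compose[OF err] filterlim_compose[OF ln_at_top] dist)
  then have lower: "((\<lambda>z. 1 - err (ln (case z of (x, y) \<Rightarrow> eucl_dist x y))) \<longlongrightarrow> 1) ?F" by simp
  have "(?P \<longlongrightarrow> 1) ?F"
  proof (rule tendsto_sandwich[OF _ _ lower tendsto_const])
    have "\<forall>\<^sub>F z in ?F. 1 \<le> (case z of (x, y) \<Rightarrow> eucl_dist x y)"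
      using dist eventually_ge_at_top[of 1] by (simp add: filterlim_iff)
    then show "\<forall>\<^sub>F z in ?F. 1 - err (ln (case z of (x, y) \<Rightarrow> eucl_dist x y)) \<le> ?P z"
    proof eventually_elim
      fix z assume "1 \<le> (case z of (x :: int ^ 'd, y) \<Rightarrow> eucl_dist x y)"
      moreover obtain x y where "z = (x, y)" by (cases z)
      ultimately have "z = (x, y)" "x \<noteq> y" by auto
      then show "1 - err (ln (case z of (x, y) \<Rightarrow> eucl_dist x y)) \<le> ?P z"
        using main by simp
    qed
    show "\<forall>\<^sub>F z in ?F. ?P z \<le> 1" by (intro always_eventually) auto
  qed
  then show "((\<lambda>(x, y). measure M {\<omega> \<in> space M.
        ereal (ln (eucl_dist x y) powr Delta (min \<alpha> ((\<tau> - 1) / 2) - \<epsilon>))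
          \<le> cost_dist (scale_free_percolation.edges L \<omega>) (\<lambda>e. C e \<omega>) x y})
      \<longlongrightarrow> 1) (filtercomap (\<lambda>(x, y). eucl_dist x y) at_top)"
    unfolding a_def b0_def \<gamma>_def .
qed

end
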